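(* Let $F(z,w,w')=0$ be an irreducible first order algebraic differential equation, where $F$ is a polynomial in $w,w'$ with coefficients in $\mathbb{C}(z)$. If $F(z,w,w')=0$ admits a non-constant rational general solution, then for all but finitely many $z_0\in\mathbb{C}$ the genus of the algebraic curve $F(z_0,x,y)=0$ (in the variables $x=w$, $y=w'$, with $z=z_0$ fixed) is zero.
   Context: Here $w'=dw/dz$. The equation is called irreducible if $F$ is irreducible as a polynomial in $w,w'$ over $\mathbb{C}(z)$; it is of first order, i.e. $w'$ actually occurs in $F$. A general solution of $F(z,w,w')=0$ is a family of solutions $w(z,\lambda)$ depending (effectively) on an arbitrary constant $\lambda$. It is called a rational general solution if it is rational in $z$ and $\lambda$; that is, $w=r(z,\lambda)\in\mathbb{C}(z,\lambda)$ with $\partial r/\partial\lambda\neq 0$ and $F\big(z,r(z,\lambda),\tfrac{\partial r}{\partial z}(z,\lambda)\big)=0$ identically. It is non-constant if it is not constant as a function of $z$. The genus of a plane curve is its geometric genus (the genus of a smooth projective model). *)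

theory Defs
  imports
    "HOL-Algebra.Algebraic_Closure_Type"
    "HOL-Computational_Algebra.Computational_Algebra"
    "HOL-Library.Extended_Nat"
    "Jordan_Normal_Form.Missing_VectorSpace"
begin

section \<open>Differential equations over \<open>\<complex>(z)\<close> and their rational general solutions\<close>

text \<open>
  \<open>\<complex>(z)\<close> is \<^typ>\<open>complex poly fract\<close> and \<open>\<complex>(z,\<lambda>)\<close> is taken to be \<open>\<complex>(z)(\<lambda>)\<close>, i.e.
  \<^typ>\<open>complex poly fract poly fract\<close>. An element of \<open>\<complex>(z)[w,w']\<close> is a
  \<^typ>\<open>complex poly fract poly poly\<close>; here, and in \<open>\<complex>[x,y]\<close>, the outer variable is \<open>w'\<close>
  (respectively \<open>y\<close>) and the inner one \<open>w\<close> (respectively \<open>x\<close>).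
\<close>

type_synonym ratfun_z = "complex poly fract"
type_synonym ratfun_z_lam = "ratfun_z poly fract"
type_synonym diff_poly = "ratfun_z poly poly"

text \<open>
  The extension of a derivation \<open>\<delta>\<close> of an integral domain to its field of fractions by the
  quotient rule; for derivations it does not depend on the chosen fraction, see
  \<open>fract_deriv_Fract\<close>.
\<close>

definition fract_deriv :: "('a::idom \<Rightarrow> 'a) \<Rightarrow> 'a fract \<Rightarrow> 'a fract" where
  "fract_deriv \<delta> r =
     (THE s. \<forall>p q. q \<noteq> 0 \<longrightarrow> r = Fract p q \<longrightarrow> s = Fract (\<delta> p * q - p * \<delta> q) (q\<^sup>2))"

lemma fract_deriv_Fract:
  fixes \<delta> :: "'a::idom \<Rightarrow> 'a"
  assumes Leibniz: "\<And>a b. \<delta> (a * b) = \<delta> a * b + a * \<delta> b" and q: "q \<noteq> 0"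
  shows "fract_deriv \<delta> (Fract p q) = Fract (\<delta> p * q - p * \<delta> q) (q\<^sup>2)"
proof -
  have wd: "Fract (\<delta> p * q - p * \<delta> q) (q\<^sup>2) = Fract (\<delta> p' * q' - p' * \<delta> q') (q'\<^sup>2)"
    if "q' \<noteq> 0" and eq: "Fract p q = Fract p' q'" for p' q'
  proof -
    have e: "p * q' = p' * q"
      using eq q that(1) by (simp add: eq_fract)
    have "\<delta> (p * q') = \<delta> (p' * q)"
      by (simp add: e)
    hence d: "\<delta> p * q' + p * \<delta> q' = \<delta> p' * q + p' * \<delta> q"
      by (simp add: Leibniz)
    have "(\<delta> p * q - p * \<delta> q) * q'\<^sup>2 - (\<delta> p' * q' - p' * \<delta> q') * q\<^sup>2
        = q * q' * ((\<delta> p * q' + p * \<delta> q') - (\<delta> p' * q + p' * \<delta> q))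
          + (p' * q - p * q') * (q' * \<delta> q + q * \<delta> q')"
      by (simp add: algebra_simps power2_eq_square)
    also have "\<dots> = 0"
      by (simp add: d e)
    finally show ?thesis
      using q that(1) by (simp add: eq_fract)
  qed
  show ?thesis
    unfolding fract_deriv_def using q wd by (intro the_equality) blast+
qed

lemma fract_deriv_add:
  fixes \<delta> :: "'a::idom \<Rightarrow> 'a"
  assumes add: "\<And>a b. \<delta> (a + b) = \<delta> a + \<delta> b"
    and Leibniz: "\<And>a b. \<delta> (a * b) = \<delta> a * b + a * \<delta> b"
  shows "fract_deriv \<delta> (r + s) = fract_deriv \<delta> r + fract_deriv \<delta> s"
proof -
  obtain a b where r: "r = Fract a b" "b \<noteq> 0" by (cases r)
  obtain c d where s: "s = Fract c d" "d \<noteq> 0" by (cases s)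
  show ?thesis
    using r s
    by (simp add: fract_deriv_Fract Leibniz add eq_fract algebra_simps power2_eq_square)
qed

lemma fract_deriv_mult:
  fixes \<delta> :: "'a::idom \<Rightarrow> 'a"
  assumes Leibniz: "\<And>a b. \<delta> (a * b) = \<delta> a * b + a * \<delta> b"
  shows "fract_deriv \<delta> (r * s) = fract_deriv \<delta> r * s + r * fract_deriv \<delta> s"
proof -
  obtain a b where r: "r = Fract a b" "b \<noteq> 0" by (cases r)
  obtain c d where s: "s = Fract c d" "d \<noteq> 0" by (cases s)
  show ?thesis
    using r s
    by (simp add: fract_deriv_Fract Leibniz eq_fract algebra_simps power2_eq_square)
qed

lemma map_poly_Leibniz:
  fixes \<delta> :: "'a::comm_ring_1 \<Rightarrow> 'a"
  assumes add: "\<And>a b. \<delta> (a + b) = \<delta> a + \<delta> b"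
    and Leibniz: "\<And>a b. \<delta> (a * b) = \<delta> a * b + a * \<delta> b"
  shows "map_poly \<delta> (p * q) = map_poly \<delta> p * q + p * map_poly \<delta> q"
proof -
  have 0: "\<delta> 0 = 0"
    using add[of 0 0] by simp
  have sum: "\<delta> (\<Sum>i\<in>A. f i) = (\<Sum>i\<in>A. \<delta> (f i))" if "finite A" for A and f :: "nat \<Rightarrow> 'a"
    using that by induction (simp_all add: 0 add)
  show ?thesis
    by (rule poly_eqI) (simp add: coeff_map_poly 0 coeff_mult sum Leibniz sum.distrib)
qed

definition deriv_z :: "ratfun_z_lam \<Rightarrow> ratfun_z_lam" where
  "deriv_z = fract_deriv (map_poly (fract_deriv pderiv))"

definition deriv_lam :: "ratfun_z_lam \<Rightarrow> ratfun_z_lam" where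
  "deriv_lam = fract_deriv pderiv"

lemma deriv_lam_Fract:
  "q \<noteq> 0 \<Longrightarrow> deriv_lam (Fract p q) = Fract (pderiv p * q - p * pderiv q) (q\<^sup>2)"
  unfolding deriv_lam_def by (rule fract_deriv_Fract) (simp_all add: pderiv_mult)

lemma deriv_z_Fract:
  fixes p q :: "ratfun_z poly"
  defines "D \<equiv> map_poly (fract_deriv pderiv)"
  assumes "q \<noteq> 0"
  shows "deriv_z (Fract p q) = Fract (D p * q - p * D q) (q\<^sup>2)"
  unfolding deriv_z_def D_def
  by (rule fract_deriv_Fract)
     (simp_all add: assms map_poly_Leibniz fract_deriv_add fract_deriv_mult pderiv_add pderiv_mult)

definition const_in_lam :: "ratfun_z \<Rightarrow> ratfun_z_lam" where
  "const_in_lam c = to_fract [:c:]"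

text \<open>\<open>F(z, u, v)\<close> for \<open>u, v \<in> \<complex>(z,\<lambda>)\<close>.\<close>

definition subst_diff_poly :: "diff_poly \<Rightarrow> ratfun_z_lam \<Rightarrow> ratfun_z_lam \<Rightarrow> ratfun_z_lam" where
  "subst_diff_poly F u v = poly (map_poly (\<lambda>c. poly (map_poly const_in_lam c) u) F) v"

definition rational_general_solution :: "diff_poly \<Rightarrow> ratfun_z_lam \<Rightarrow> bool" where
  "rational_general_solution F r \<longleftrightarrow> deriv_lam r \<noteq> 0 \<and> subst_diff_poly F r (deriv_z r) = 0"

text \<open>\<open>r\<close> is constant as a function of \<open>z\<close>, i.e. lies in \<open>\<complex>(\<lambda>)\<close>.\<close>

definition constant_in_z :: "ratfun_z_lam \<Rightarrow> bool" where
  "constant_in_z r \<longleftrightarrow> (\<exists>p q :: complex poly. q \<noteq> 0 \<and>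
     r = Fract (map_poly (\<lambda>c. to_fract [:c:]) p) (map_poly (\<lambda>c. to_fract [:c:]) q))"

text \<open>
  The value of a rational function at \<open>z\<^sub>0\<close>, computed from the reduced fraction. At a pole it
  is the junk value \<open>0\<close>, so \<open>specialize z\<^sub>0 F\<close> is meaningful only if no coefficient of \<open>F\<close>
  has a pole at \<open>z\<^sub>0\<close>, i.e. for all but finitely many \<open>z\<^sub>0\<close>.
\<close>

definition ratfun_eval :: "complex \<Rightarrow> ratfun_z \<Rightarrow> complex" where
  "ratfun_eval z\<^sub>0 c = poly (fst (quot_of_fract c)) z\<^sub>0 / poly (snd (quot_of_fract c)) z\<^sub>0"

definition specialize :: "complex \<Rightarrow> diff_poly \<Rightarrow> complex poly poly" where
  "specialize z\<^sub>0 F = map_poly (map_poly (ratfun_eval z\<^sub>0)) F"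


section \<open>The genus of a function field\<close>

text \<open>
  Let \<open>K\<close> be a field of algebraic functions of one variable over a subfield \<open>k\<close> of
  characteristic \<open>0\<close>. The points of its smooth projective model \<open>X\<close> are the places of \<open>K / k\<close>;
  a place is given by its valuation ring \<open>V\<close>, which is the local ring of \<open>X\<close> at that point.
\<close>

definition places :: "('a, 'm) ring_scheme \<Rightarrow> 'a set \<Rightarrow> 'a set set" where
  "places K k = {V. subring V K \<and> k \<subseteq> V \<and> V \<noteq> carrier K \<and>
     (\<forall>u \<in> carrier K. u \<notin> V \<longrightarrow> inv\<^bsub>K\<^esub> u \<in> V)}"

definition derivations :: "('a, 'm) ring_scheme \<Rightarrow> 'a set \<Rightarrow> ('a \<Rightarrow> 'a) set" where
  "derivations K k = {D \<in> carrier K \<rightarrow>\<^sub>E carrier K.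
     (\<forall>u \<in> carrier K. \<forall>v \<in> carrier K. D (u \<oplus>\<^bsub>K\<^esub> v) = D u \<oplus>\<^bsub>K\<^esub> D v) \<and>
     (\<forall>u \<in> carrier K. \<forall>v \<in> carrier K.
        D (u \<otimes>\<^bsub>K\<^esub> v) = (D u \<otimes>\<^bsub>K\<^esub> v) \<oplus>\<^bsub>K\<^esub> (u \<otimes>\<^bsub>K\<^esub> D v)) \<and>
     (\<forall>c \<in> k. D c = \<zero>\<^bsub>K\<^esub>)}"

text \<open>
  As \<open>\<Omega>(K/k)\<close> is a finite-dimensional \<open>K\<close>-vector space with dual \<open>Der(K/k)\<close>, a differential is
  represented by the function \<open>Der(K/k) \<rightarrow> K\<close> it induces; \<open>du\<close> becomes \<open>D \<mapsto> D u\<close>.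
\<close>

abbreviation differential_space ::
    "('a, 'm) ring_scheme \<Rightarrow> 'a set \<Rightarrow> ('a, ('a \<Rightarrow> 'a) \<Rightarrow> 'a) module" where
  "differential_space K k \<equiv> ring.func_space K (derivations K k)"

definition differential ::
    "('a, 'm) ring_scheme \<Rightarrow> 'a set \<Rightarrow> 'a \<Rightarrow> (('a \<Rightarrow> 'a) \<Rightarrow> 'a)" where
  "differential K k u = (\<lambda>D \<in> derivations K k. D u)"

text \<open>
  The \<open>S\<close>-submodule of \<open>\<Omega>(K/k)\<close> spanned by all \<open>du\<close> with \<open>u \<in> S\<close>. This is \<open>\<Omega>(K/k)\<close> for
  \<open>S = carrier K\<close>, and the stalk of the sheaf of differentials of \<open>X\<close> at \<open>V\<close> for a place
  \<open>S = V\<close>.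
\<close>

definition differentials_over ::
    "('a, 'm) ring_scheme \<Rightarrow> 'a set \<Rightarrow> 'a set \<Rightarrow> (('a \<Rightarrow> 'a) \<Rightarrow> 'a) set" where
  "differentials_over K k S =
     module.span (K\<lparr>carrier := S\<rparr>) (differential_space K k) (differential K k ` S)"

definition regular_differentials ::
    "('a, 'm) ring_scheme \<Rightarrow> 'a set \<Rightarrow> (('a \<Rightarrow> 'a) \<Rightarrow> 'a) set" where
  "regular_differentials K k =
     differentials_over K k (carrier K) \<inter> (\<Inter>V \<in> places K k. differentials_over K k V)"

text \<open>
  The genus of \<open>X\<close> is the dimension over \<open>k\<close> of the space of its global regular differentials.
\<close>

definition function_field_genus :: "('a, 'm) ring_scheme \<Rightarrow> 'a set \<Rightarrow> enat" where
  "function_field_genus K k =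
     (let k_field = K\<lparr>carrier := k\<rparr>;
          \<Omega> = (differential_space K k)\<lparr>carrier := regular_differentials K k\<rparr>
      in if vectorspace.fin_dim k_field \<Omega> then enat (vectorspace.dim k_field \<Omega>) else \<infinity>)"


section \<open>The genus of an irreducible plane curve\<close>

text \<open>
  For irreducible \<open>f \<in> \<complex>[x,y]\<close>, the function field of the curve \<open>f = 0\<close>, i.e. the field of
  fractions of \<open>\<complex>[x,y]/(f)\<close>, is obtained as the residue field of the localization of \<open>\<complex>[x,y]\<close>
  at the prime ideal \<open>(f)\<close>.
\<close>

definition curve_local_ring :: "complex poly poly \<Rightarrow> complex poly poly fract ring" where
  "curve_local_ring f = ring_of_type_algebra\<lparr>carrier := {Fract p q | p q. \<not> f dvd q}\<rparr>"

definition curve_ideal :: "complex poly poly \<Rightarrow> complex poly poly fract set" where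
  "curve_ideal f = {Fract p q | p q. f dvd p \<and> \<not> f dvd q}"

definition curve_function_field :: "complex poly poly \<Rightarrow> complex poly poly fract set ring" where
  "curve_function_field f = curve_local_ring f Quot curve_ideal f"

definition curve_constants :: "complex poly poly \<Rightarrow> complex poly poly fract set set" where
  "curve_constants f =
     {curve_ideal f +>\<^bsub>curve_local_ring f\<^esub> to_fract [:[:c:]:] | c. c \<in> UNIV}"

definition plane_curve_genus :: "complex poly poly \<Rightarrow> enat" where
  "plane_curve_genus f = function_field_genus (curve_function_field f) (curve_constants f)"

end

theory Submission
  imports Defs "Berlekamp_Zassenhaus.Unique_Factorization_Poly"
begin

text \<open>
  Write \<open>K = \<complex>(z)\<close> and let \<open>(r, s)\<close> with \<open>s = \<partial>r/\<partial>z\<close> be the given point of \<open>F = 0\<close> over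
  \<open>K(\<lambda>)\<close>. As \<open>r\<close> is transcendental over \<open>K\<close> and \<open>F\<close> is prime, the polynomials vanishing at
  \<open>(r, s)\<close> are the multiples of \<open>F\<close>, so the monomials \<open>r\<^sup>i s\<^sup>j\<close> in which the degree in one of the
  variables is smaller than that of \<open>F\<close> are linearly independent over \<open>K\<close>. Linear independence of a
  finite family survives the substitution of almost every \<open>z\<^sub>0\<close> for \<open>z\<close>. Hence a factor of
  \<open>F(z\<^sub>0, x, y)\<close> that vanishes at the specialized point has full degree in both variables, and
  its cofactor is constant: \<open>F(z\<^sub>0, x, y)\<close> is irreducible.

  The function field of the specialized curve now embeds into \<open>\<complex>(\<lambda>)\<close>. A regular differential
  pulls back to a differential \<open>g d\<lambda>\<close> such that \<open>g\<close> has no pole in \<open>\<complex>\<close> and a zero of order at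
  least two at infinity; so it vanishes.
\<close>

subsection \<open>Evaluation of polynomials at rational functions\<close>

text \<open>With this instance and the next one \<complex>(z) is a field of characteristic 0, so
  that arguments by differentiation apply with \<complex>(z) as the field of constants.\<close>

instance fract :: ("{idom, ring_char_0}") ring_char_0
proof
  show "inj (of_nat :: nat \<Rightarrow> 'a fract)"
    by (rule injI) (simp add: of_nat_fract eq_fract)
qed

instance fract :: ("{idom, ring_char_0}") field_char_0 ..

text \<open>The base field is left generic because the evaluations are used twice: over
  \<complex>(z) for the given solution, and over \<complex> for the specialized curves.\<close>

definition const_fract :: "'k::field \<Rightarrow> 'k poly fract" where
  "const_fract c = to_fract [:c:]"

definition eval1 :: "'k::field poly \<Rightarrow> 'k poly fract \<Rightarrow> 'k poly fract" where
  "eval1 p u = poly (map_poly const_fract p) u"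

definition eval2 :: "'k::field poly poly \<Rightarrow> 'k poly fract \<Rightarrow> 'k poly fract \<Rightarrow> 'k poly fract"
  where "eval2 F u v = poly (map_poly (\<lambda>c. eval1 c u) F) v"

interpretation const_fract: inj_idom_hom const_fract
  by unfold_locales
    (auto simp: const_fract_def simp flip: to_fract_add to_fract_mult to_fract_1)

interpretation eval1: idom_hom "\<lambda>p. eval1 p (u :: 'a::field poly fract)"
proof -
  interpret map_poly_comm_ring_hom "const_fract :: 'a \<Rightarrow> _" ..
  show "idom_hom (\<lambda>p. eval1 p (u :: 'a poly fract))"
    by unfold_locales (simp_all add: eval1_def hom_distribs)
qed

interpretation eval2: idom_hom "\<lambda>F. eval2 F u v"
proof -
  interpret map_poly_comm_ring_hom "\<lambda>p. eval1 p u" ..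
  show "idom_hom (\<lambda>F. eval2 F u v)"
    by unfold_locales (simp_all add: eval2_def hom_distribs)
qed

lemma eval2_eq_subst_diff_poly: "subst_diff_poly F u v = eval2 F u v"
  by (simp add: subst_diff_poly_def eval2_def eval1_def const_in_lam_def[abs_def]
      const_fract_def[abs_def])

lemma eval1_const [simp]: "eval1 [:c:] u = const_fract c"
  by (simp add: eval1_def const_fract.map_poly_pCons_hom)

lemma eval1_X [simp]: "eval1 (pCons 0 1) u = u"
  by (simp add: eval1_def const_fract.map_poly_pCons_hom)

lemma eval2_pCons [simp]: "eval2 (pCons c F) u v = eval1 c u + v * eval2 F u v"
  by (simp add: eval2_def eval1.map_poly_pCons_hom)

lemma eval2_smult [simp]: "eval2 (smult c F) u v = eval1 c u * eval2 F u v"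
  using eval2.hom_mult[of "[:c:]" F u v] by simp

lemma poly_altdef_le:
  fixes p :: "'a::comm_semiring_1 poly"
  assumes "degree p \<le> n"
  shows "poly p x = (\<Sum>i\<le>n. coeff p i * x ^ i)"
proof -
  have "poly p x = (\<Sum>i\<le>degree p. coeff p i * x ^ i)"
    by (simp add: poly_altdef)
  also have "\<dots> = (\<Sum>i\<le>n. coeff p i * x ^ i)"
    using assms by (intro sum.mono_neutral_left) (auto simp: not_le coeff_eq_0)
  finally show ?thesis .
qed

lemma eval1_altdef:
  assumes "degree p \<le> m"
  shows "eval1 p u = (\<Sum>i\<le>m. const_fract (coeff p i) * u ^ i)"
  using assms unfolding eval1_def
  by (subst poly_altdef_le[of _ m]) (auto simp: coeff_map_poly intro: le_trans[OF degree_map_poly_le])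

lemma eval2_altdef:
  assumes "degree F \<le> n"
  shows "eval2 F u v = (\<Sum>j\<le>n. eval1 (coeff F j) u * v ^ j)"
  using assms unfolding eval2_def
  by (subst poly_altdef_le[of _ n]) (auto simp: coeff_map_poly intro: le_trans[OF degree_map_poly_le])

text \<open>\<open>(P / Q)\<^sup>i (U / Q)\<^sup>j\<close> multiplied by the common denominator \<open>Q\<^bsup>m+n\<^esup>\<close>.\<close>

definition hmonom :: "nat \<Rightarrow> nat \<Rightarrow> 'a::comm_semiring_1 \<Rightarrow> 'a \<Rightarrow> 'a \<Rightarrow> nat \<times> nat \<Rightarrow> 'a" where
  "hmonom m n P U Q = (\<lambda>(i, j). P ^ i * U ^ j * (Q ^ (m - i) * Q ^ (n - j)))"

text \<open>Both coordinates have the same denominator, so a fixed power of \<open>Q\<close> turns a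
  zero of \<open>F\<close> into a linear relation between polynomials in \<lambda> whose
  coefficients are those of \<open>F\<close>.\<close>

lemma eval2_hmonom:
  fixes P U Q :: "'k::field poly"
  assumes "degree F \<le> n" "\<And>j. degree (coeff F j) \<le> m" "Q \<noteq> 0"
  shows "eval2 F (Fract P Q) (Fract U Q) * to_fract Q ^ (m + n) =
    to_fract (\<Sum>(i, j)\<in>{..m} \<times> {..n}. smult (coeff (coeff F j) i) (hmonom m n P U Q (i, j)))"
proof -
  let ?q = "to_fract Q"
  have q: "?q \<noteq> 0"
    using assms(3) by simp
  have pow: "Fract A Q ^ i * ?q ^ k = to_fract (A ^ i * Q ^ (k - i))" if "i \<le> k" for A i k
  proof -
    have "Fract A Q ^ i = to_fract A ^ i / ?q ^ i"
      by (simp add: Fract_conv_to_fract power_divide)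
    moreover have "?q ^ k = ?q ^ i * ?q ^ (k - i)"
      using that by (simp flip: power_add)
    ultimately show ?thesis
      using q by (simp add: hom_distribs)
  qed
  have "eval2 F (Fract P Q) (Fract U Q) * ?q ^ (m + n) =
    (\<Sum>j\<le>n. \<Sum>i\<le>m. const_fract (coeff (coeff F j) i) * 
       ((Fract P Q ^ i * ?q ^ m) * (Fract U Q ^ j * ?q ^ n)))"
    by (simp add: eval2_altdef[OF assms(1)] eval1_altdef[OF assms(2)] sum_distrib_left
        sum_distrib_right power_add mult_ac)
  also have "\<dots> = (\<Sum>j\<le>n. \<Sum>i\<le>m.
      to_fract (smult (coeff (coeff F j) i) (hmonom m n P U Q (i, j))))"
  proof (intro sum.cong refl)
    fix i j assume *: "i \<in> {..m}" "j \<in> {..n}"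
    have "const_fract (coeff (coeff F j) i) * 
       ((Fract P Q ^ i * ?q ^ m) * (Fract U Q ^ j * ?q ^ n)) =
       to_fract ([:coeff (coeff F j) i:] * ((P ^ i * Q ^ (m - i)) * (U ^ j * Q ^ (n - j))))"
      using * by (simp only: pow atMost_iff const_fract_def to_fract_mult)
    also have "[:coeff (coeff F j) i:] * ((P ^ i * Q ^ (m - i)) * (U ^ j * Q ^ (n - j))) =
      smult (coeff (coeff F j) i) (hmonom m n P U Q (i, j))"
      by (simp add: hmonom_def mult_ac)
    finally show "const_fract (coeff (coeff F j) i) * 
       ((Fract P Q ^ i * ?q ^ m) * (Fract U Q ^ j * ?q ^ n)) =
       to_fract (smult (coeff (coeff F j) i) (hmonom m n P U Q (i, j)))" .
  qed
  also have "\<dots> = to_fract (\<Sum>j\<le>n. \<Sum>i\<le>m. smult (coeff (coeff F j) i) (hmonom m n P U Q (i, j)))"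
    by (simp add: to_fract_hom.hom_sum)
  also have "(\<Sum>j\<le>n. \<Sum>i\<le>m. smult (coeff (coeff F j) i) (hmonom m n P U Q (i, j))) =
     (\<Sum>(i, j)\<in>{..m} \<times> {..n}. smult (coeff (coeff F j) i) (hmonom m n P U Q (i, j)))"
    by (subst sum.swap) (simp add: sum.cartesian_product)
  finally show ?thesis .
qed

subsection \<open>Derivations\<close>

text \<open>The map \<open>E\<close> has to be a derivation on \<open>M\<close> only, since it will
  be transported along an embedding whose image is \<open>M\<close>.\<close>

lemma derivation_poly:
  fixes E :: "'a::idom \<Rightarrow> 'a"
  assumes M: "0 \<in> M" "\<And>a b. a \<in> M \<Longrightarrow> b \<in> M \<Longrightarrow> a + b \<in> M"
      "\<And>a b. a \<in> M \<Longrightarrow> b \<in> M \<Longrightarrow> a * b \<in> M"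
    and add: "\<And>a b. a \<in> M \<Longrightarrow> b \<in> M \<Longrightarrow> E (a + b) = E a + E b"
    and Leibniz: "\<And>a b. a \<in> M \<Longrightarrow> b \<in> M \<Longrightarrow> E (a * b) = E a * b + a * E b"
    and C: "\<And>i. coeff C i \<in> M" "\<And>i. E (coeff C i) = 0" and x: "x \<in> M"
  shows "poly C x \<in> M \<and> E (poly C x) = poly (pderiv C) x * E x"
  using C
proof (induction C)
  case 0
  then show ?case
    using M(1) by simp
next
  case (pCons c C)
  have c: "c \<in> M" "E c = 0"
    using pCons.prems[of 0] by simp_all
  have IH: "poly C x \<in> M" "E (poly C x) = poly (pderiv C) x * E x"
    using pCons.IH pCons.prems[of "Suc _"] by simp_all
  show ?case
    using c IH x M by (simp add: add Leibniz pderiv_pCons algebra_simps)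
qed

definition deriv_fract :: "'k::field poly fract \<Rightarrow> 'k poly fract" where
  "deriv_fract = fract_deriv pderiv"

lemma deriv_fract_Fract:
  "q \<noteq> 0 \<Longrightarrow> deriv_fract (Fract p q) = Fract (pderiv p * q - p * pderiv q) (q\<^sup>2)"
  unfolding deriv_fract_def by (rule fract_deriv_Fract) (simp_all add: pderiv_mult)

lemma deriv_fract_add: "deriv_fract (a + b) = deriv_fract a + deriv_fract b"
  unfolding deriv_fract_def by (rule fract_deriv_add) (simp_all add: pderiv_add pderiv_mult)

lemma deriv_fract_mult: "deriv_fract (a * b) = deriv_fract a * b + a * deriv_fract b"
  unfolding deriv_fract_def by (rule fract_deriv_mult) (simp_all add: pderiv_mult)

lemma deriv_fract_const [simp]: "deriv_fract (const_fract c) = 0"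
  by (simp add: const_fract_def to_fract_def deriv_fract_Fract Zero_fract_def[symmetric])

lemma deriv_fract_eval1: "deriv_fract (eval1 p u) = eval1 (pderiv p) u * deriv_fract u"
  unfolding eval1_def const_fract.map_poly_pderiv
  using derivation_poly[of UNIV deriv_fract "map_poly const_fract p" u]
  by (simp add: deriv_fract_add deriv_fract_mult coeff_map_poly)

text \<open>Differentiating p(u) = 0 gives p'(u) u' = 0, a relation of smaller degree that is again
  nontrivial in characteristic 0. Descent on the degree shows that \<open>u\<close> is
  transcendental over the constants.\<close>

lemma eval1_eq_0_iff:
  fixes p :: "'k::field_char_0 poly"
  assumes u: "deriv_fract u \<noteq> 0"
  shows "eval1 p u = 0 \<longleftrightarrow> p = 0"
proof (induction "degree p" arbitrary: p rule: less_induct)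
  case less
  show ?case
  proof (cases "degree p = 0")
    case True
    then show ?thesis
      by (auto elim!: degree_eq_zeroE)
  next
    case False
    have "eval1 p u \<noteq> 0"
    proof
      assume "eval1 p u = 0"
      hence "eval1 (pderiv p) u = 0"
        using deriv_fract_eval1[of p u] u deriv_fract_const[of "0 :: 'k"] by auto
      moreover have "degree (pderiv p) < degree p"
        using False by (simp add: degree_pderiv)
      ultimately have "pderiv p = 0"
        using less by blast
      thus False
        using False by (simp add: pderiv_eq_0_iff)
    qed
    thus ?thesis
      using False by auto
  qed
qed


subsection \<open>The kernel of an evaluation\<close>

text \<open>Over the field k(x) the kernel would be generated by an element of least degree;
  pseudo-division imitates this up to factors from k[x]. Such factors are harmless: a nonzero one
  does not vanish at the transcendental \<open>u\<close>, and \<open>f\<close>, having positive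
  degree, does not divide it.\<close>

lemma irreducible_dvd_of_eval2_eq_0:
  fixes f g :: "'k::field_char_0 poly poly"
  assumes f: "irreducible f" "degree f > 0" "eval2 f u v = 0" and u: "deriv_fract u \<noteq> 0"
    and g: "eval2 g u v = 0"
  shows "f dvd g"
proof -
  have prime: "prime_elem f"
    using f(1) by simp
  have const: "degree h > 0" if "eval2 h u v = 0" "h \<noteq> 0" for h
  proof (rule ccontr)
    assume "\<not> degree h > 0"
    then obtain c where "h = [:c:]"
      by (auto elim: degree_eq_zeroE)
    thus False
      using that eval1_eq_0_iff[OF u] by simp
  qed
  have not_dvd: "\<not> f dvd [:c:]" if "c \<noteq> 0" for c
    using f(2) that by (metis degree_pCons_0 dvd_imp_degree_le leD pCons_eq_0_iff)
  have "f \<noteq> 0 \<and> eval2 f u v = 0"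
    using f by auto
  from ex_has_least_nat[where P = "\<lambda>h. h \<noteq> 0 \<and> eval2 h u v = 0", OF this, of degree]
  obtain d where d: "d \<noteq> 0" "eval2 d u v = 0"
    and d_min: "\<And>h. h \<noteq> 0 \<Longrightarrow> eval2 h u v = 0 \<Longrightarrow> degree d \<le> degree h"
    by blast
  have quot: "\<exists>c q. c \<noteq> 0 \<and> smult c h = d * q" if "eval2 h u v = 0" for h
  proof -
    obtain q r where qr: "pseudo_divmod h d = (q, r)"
      by fastforce
    define c where "c = lead_coeff d ^ (Suc (degree h) - degree d)"
    have 1: "smult c h = d * q + r" and 2: "r = 0 \<or> degree r < degree d"
      using pseudo_divmod[OF d(1) qr] by (simp_all add: c_def)
    have "eval2 r u v = 0"
      using arg_cong[OF 1, of "\<lambda>h. eval2 h u v"] that d by (simp add: eval2.hom_add eval2.hom_mult)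
    hence "r = 0"
      using 2 d_min[of r] by (metis leD)
    thus ?thesis
      using 1 d(1) by (intro exI[of _ c] exI[of _ q]) (simp add: c_def)
  qed
  obtain c q where c: "c \<noteq> 0" "smult c f = d * q"
    using quot[OF f(3)] by blast
  have "f dvd d * q"
    using c(2) by (metis dvd_refl dvd_smult)
  hence "f dvd d \<or> f dvd q"
    using prime by (simp add: prime_elem_dvd_mult_iff)
  \<comment> \<open>Otherwise cancelling \<open>f\<close> in \<open>smult c f = d * q\<close> makes
    \<open>d\<close> a divisor of the constant \<open>c\<close>, whereas nonzero elements of the
    kernel have positive degree.\<close>
  moreover have "\<not> f dvd q"
  proof
    assume "f dvd q"
    then obtain e where "q = f * e"
      by blast
    hence "[:c:] * f = (d * e) * f"
      using c(2) by (simp add: mult_ac)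
    moreover have "f \<noteq> 0"
      using f(2) by auto
    ultimately have "[:c:] = d * e"
      by (metis mult_right_cancel)
    hence "degree d = 0"
      using c(1) by (metis dvd_triv_left degree_pCons_0 dvd_imp_degree_le le_zero_eq pCons_eq_0_iff)
    thus False
      using const[OF d(2,1)] by simp
  qed
  ultimately have "f dvd d"
    by blast
  moreover obtain c' q' where c': "c' \<noteq> 0" "smult c' g = d * q'"
    using quot[OF g] by blast
  ultimately have "f dvd [:c':] * g"
    by simp
  hence "f dvd [:c':] \<or> f dvd g"
    by (rule prime_elem_dvd_multD[OF prime])
  thus ?thesis
    using not_dvd[OF c'(1)] by blast
qed

subsection \<open>The degree in the inner variable\<close>

definition degree_inner :: "'a::zero poly poly \<Rightarrow> nat" where
  "degree_inner F = Max ((\<lambda>j. degree (coeff F j)) ` {..degree F})"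

lemma degree_coeff_le: "degree (coeff F j) \<le> degree_inner F"
proof (cases "j \<le> degree F")
  case True
  thus ?thesis
    unfolding degree_inner_def by (intro Max_ge) auto
next
  case False
  thus ?thesis
    by (simp add: coeff_eq_0)
qed

lemma degree_inner_attained: "\<exists>j\<le>degree F. degree (coeff F j) = degree_inner F"
proof -
  have "degree_inner F \<in> (\<lambda>j. degree (coeff F j)) ` {..degree F}"
    unfolding degree_inner_def by (intro Max_in) auto
  thus ?thesis
    by auto
qed

lemma degree_inner_le_iff: "degree_inner F \<le> m \<longleftrightarrow> (\<forall>j. degree (coeff F j) \<le> m)"
  by (metis degree_coeff_le degree_inner_attained order_trans)

lemma coeff_mult_degree_bounds:
  fixes p q :: "'a::comm_semiring_0 poly"
  assumes "degree p \<le> a" "degree q \<le> b"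
  shows "coeff (p * q) (a + b) = coeff p a * coeff q b"
proof -
  have "coeff (p * q) (a + b) = (\<Sum>i\<le>a + b. coeff p i * coeff q (a + b - i))"
    by (rule coeff_mult)
  also have "\<dots> = (\<Sum>i\<in>{a}. coeff p i * coeff q (a + b - i))"
  proof (rule sum.mono_neutral_right)
    show "\<forall>i\<in>{..a + b} - {a}. coeff p i * coeff q (a + b - i) = 0"
    proof
      fix i assume "i \<in> {..a + b} - {a}"
      hence "i < a \<or> i > a"
        by auto
      thus "coeff p i * coeff q (a + b - i) = 0"
        using assms by (auto simp: coeff_eq_0)
    qed
  qed auto
  finally show ?thesis
    by simp
qed

text \<open>The coefficient of the highest power of the inner variable is a nonzero polynomial in
  the outer one. For a product these top coefficients multiply, and polynomials over a domain form a
  domain.\<close>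

lemma degree_inner_mult_ge:
  fixes F G :: "'a::idom poly poly"
  assumes "F \<noteq> 0" "G \<noteq> 0"
  shows "degree_inner F + degree_inner G \<le> degree_inner (F * G)"
proof -
  define top where "top n H = map_poly (\<lambda>c. coeff c n) H" for n and H :: "'a poly poly"
  have coeff_top: "coeff (top n H) j = coeff (coeff H j) n" for n H j
    by (simp add: top_def coeff_map_poly)
  have top_nz: "top (degree_inner H) H \<noteq> 0" if "H \<noteq> 0" for H
  proof -
    obtain j where j: "degree (coeff H j) = degree_inner H"
      using degree_inner_attained by blast
    show ?thesis
    proof (cases "coeff H j = 0")
      \<comment> \<open>A zero coefficient has degree 0 and may attain the maximum; then all
        coefficients are constant and the leading one serves instead.\<close>
      case True
      hence "degree_inner H = 0"
        using j by simp
      hence "coeff (coeff H (degree H)) (degree_inner H) \<noteq> 0"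
        using degree_coeff_le[of H "degree H"] that by (metis le_zero_eq leading_coeff_0_iff)
      thus ?thesis
        by (metis coeff_top coeff_0)
    next
      case False
      thus ?thesis
        using j by (metis coeff_top coeff_0 leading_coeff_0_iff)
    qed
  qed
  let ?a = "degree_inner F" and ?b = "degree_inner G"
  have "top (?a + ?b) (F * G) = top ?a F * top ?b G"
    by (rule poly_eqI)
      (simp add: coeff_top coeff_mult[of F G] coeff_mult[of "top ?a F"] coeff_sum coeff_mult_degree_bounds degree_coeff_le)
  hence "top (?a + ?b) (F * G) \<noteq> 0"
    using top_nz assms by simp
  then obtain j where "coeff (coeff (F * G) j) (?a + ?b) \<noteq> 0"
    by (metis coeff_top coeff_0 poly_eqI)
  hence "?a + ?b \<le> degree (coeff (F * G) j)"
    by (rule le_degree)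
  thus ?thesis
    using degree_coeff_le order_trans by blast
qed

subsection \<open>Specialization\<close>

text \<open>Here \<lambda> is the outer variable and z the inner one: the solution enters in this
  form once its denominators in z are cleared.\<close>

definition eval_coeffs :: "'a \<Rightarrow> 'a::comm_ring_1 poly poly \<Rightarrow> 'a poly" where
  "eval_coeffs z p = map_poly (\<lambda>c. poly c z) p"

interpretation eval_coeffs: comm_ring_hom "eval_coeffs z"
proof -
  interpret map_poly_comm_ring_hom "\<lambda>c. poly c z" ..
  show "comm_ring_hom (eval_coeffs z)"
    by unfold_locales (simp_all add: eval_coeffs_def hom_distribs)
qed

lemma coeff_eval_coeffs [simp]: "coeff (eval_coeffs z p) i = poly (coeff p i) z"
  by (simp add: eval_coeffs_def coeff_map_poly)

lemma eval_coeffs_smult [simp]: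
  "eval_coeffs z (smult c p) = smult (poly c z) (eval_coeffs z p)"
  by (rule poly_eqI) simp

lemma eventually_poly_neq_0:
  fixes p :: "'a::idom poly"
  assumes "p \<noteq> 0"
  shows "\<forall>\<^sub>\<infinity>z. poly p z \<noteq> 0"
  using poly_roots_finite[OF assms] by (simp add: eventually_cofinite)

lemma eventually_eval_coeffs_neq_0:
  fixes p :: "'a::idom poly poly"
  assumes "p \<noteq> 0"
  shows "\<forall>\<^sub>\<infinity>z. eval_coeffs z p \<noteq> 0"
proof -
  have "\<forall>\<^sub>\<infinity>z. poly (lead_coeff p) z \<noteq> 0"
    using assms by (intro eventually_poly_neq_0) simp
  thus ?thesis
    by eventually_elim (metis coeff_0 coeff_eval_coeffs)
qed

text \<open>
  One step of Gaussian elimination, with a coefficient of \<open>e x\<close> as pivot, removes \<open>x\<close> from the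
  family; the pivot vanishes only at finitely many \<open>z\<close>.
\<close>

lemma eventually_independent_eval_coeffs:
  fixes e :: "'i \<Rightarrow> 'a::idom poly poly"
  assumes "finite I" "\<And>c. (\<Sum>i\<in>I. smult (c i) (e i)) = 0 \<Longrightarrow> \<forall>i\<in>I. c i = 0"
  shows "\<forall>\<^sub>\<infinity>z. \<forall>a. (\<Sum>i\<in>I. smult (a i) (eval_coeffs z (e i))) = 0 \<longrightarrow> (\<forall>i\<in>I. a i = 0)"
  using assms
proof (induction I arbitrary: e rule: finite_induct)
  case empty
  then show ?case
    by simp
next
  case (insert x I)
  have "e x \<noteq> 0"
  proof
    assume "e x = 0"
    hence "(\<Sum>i\<in>insert x I. smult (if i = x then 1 else 0) (e i)) = 0"
      by (auto intro!: sum.neutral)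
    from insert.prems[OF this] show False
      by simp
  qed
  then obtain l where l: "coeff (e x) l \<noteq> 0"
    by (metis coeff_0 poly_eqI)
  define p where "p = coeff (e x) l"
  \<comment> \<open>Cross-multiplying with the pivot instead of dividing by it keeps the
    coefficients in k[z]. The coefficient of index \<open>l\<close> of \<open>e' i\<close> is
    zero.\<close>
  define e' where "e' i = smult p (e i) - smult (coeff (e i) l) (e x)" for i
  have comb: "(\<Sum>i\<in>I. smult (c i) (e' i)) =
      (\<Sum>i\<in>insert x I. smult (if i = x then - (\<Sum>i\<in>I. c i * coeff (e i) l) else p * c i) (e i))"
    for c
  proof -
    have "(\<Sum>i\<in>I. smult (if i = x then - (\<Sum>i\<in>I. c i * coeff (e i) l) else p * c i) (e i)) =
      (\<Sum>i\<in>I. smult (p * c i) (e i))"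
      using insert.hyps by (intro sum.cong) auto
    moreover have "smult (- (\<Sum>i\<in>I. c i * coeff (e i) l)) (e x) = 
      - (\<Sum>i\<in>I. smult (c i * coeff (e i) l) (e x))"
      by (simp add: smult_sum)
    ultimately show ?thesis
      using insert.hyps
      by (simp add: e'_def smult_diff_right sum_subtractf mult_ac)
  qed
  have "\<forall>i\<in>I. c i = 0" if "(\<Sum>i\<in>I. smult (c i) (e' i)) = 0" for c
  proof
    fix i assume i: "i \<in> I"
    have "p * c i = 0"
      using insert.prems[OF that[unfolded comb]] i insert.hyps
      by (metis (no_types, lifting) insertI2)
    thus "c i = 0"
      using l by (simp add: p_def)
  qed
  from insert.IH[OF this]
  have "\<forall>\<^sub>\<infinity>z. \<forall>a. (\<Sum>i\<in>I. smult (a i) (eval_coeffs z (e' i))) = 0 \<longrightarrow> (\<forall>i\<in>I. a i = 0)"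
    by blast
  moreover have "\<forall>\<^sub>\<infinity>z. poly p z \<noteq> 0"
    using l by (intro eventually_poly_neq_0) (simp add: p_def)
  ultimately show ?case
  proof eventually_elim
    case (elim z)
    show ?case
    proof (intro allI impI)
      fix a assume a: "(\<Sum>i\<in>insert x I. smult (a i) (eval_coeffs z (e i))) = 0"
      have "coeff (\<Sum>i\<in>insert x I. smult (a i) (eval_coeffs z (e i))) l = 0"
        by (simp only: a coeff_0)
      hence coeff_l: "(\<Sum>i\<in>I. a i * poly (coeff (e i) l) z) = - (a x * poly p z)"
        using insert.hyps by (simp add: coeff_sum p_def eq_neg_iff_add_eq_0 add.commute)
      have sum_I: "(\<Sum>i\<in>I. smult (a i) (eval_coeffs z (e i))) = - smult (a x) (eval_coeffs z (e x))"
        using a insert.hyps by (simp add: eq_neg_iff_add_eq_0 add.commute)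
      \<comment> \<open>This is p(z) times the given relation minus its coefficient of index
        \<open>l\<close> times \<open>e x\<close>; the terms with \<open>a x\<close> cancel.\<close>
      have "(\<Sum>i\<in>I. smult (a i) (eval_coeffs z (e' i))) =
        smult (poly p z) (\<Sum>i\<in>I. smult (a i) (eval_coeffs z (e i)))
        - smult (\<Sum>i\<in>I. a i * poly (coeff (e i) l) z) (eval_coeffs z (e x))"
        by (simp add: e'_def eval_coeffs.hom_minus smult_diff_right sum_subtractf smult_sum
            smult_sum2 mult_ac)
      also have "\<dots> = 0"
        by (simp add: coeff_l sum_I mult_ac)
      finally have a0: "\<forall>i\<in>I. a i = 0"
        using elim by blast
      hence "a x * poly p z = 0"
        using coeff_l by simp
      thus "\<forall>i\<in>insert x I. a i = 0"
        using a0 elim by simp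
    qed
  qed
qed

text \<open>The support \<open>I\<close> is kept apart from the rectangle that fixes the power of
  the denominator. The same monomials thus serve the whole rectangle and the rectangle without its
  last row or column.\<close>

lemma eval2_eq_0_iff_hmonom:
  fixes P U Q :: "'k::field poly"
  assumes I: "I \<subseteq> {..m} \<times> {..n}" "\<And>i j. coeff (coeff F j) i \<noteq> 0 \<Longrightarrow> (i, j) \<in> I"
    and Q: "Q \<noteq> 0"
  shows "eval2 F (Fract P Q) (Fract U Q) = 0 \<longleftrightarrow>
    (\<Sum>x\<in>I. smult (coeff (coeff F (snd x)) (fst x)) (hmonom m n P U Q x)) = 0"
proof -
  have bound: "i \<le> m \<and> j \<le> n" if "coeff (coeff F j) i \<noteq> 0" for i j
    using I(2)[OF that] I(1) by auto
  have "degree (coeff F j) \<le> m" for j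
    using bound[of j "degree (coeff F j)"] by (cases "coeff F j = 0") auto
  moreover have "degree F \<le> n"
    using bound[of "degree F" "degree (lead_coeff F)"] by (cases "F = 0") auto
  ultimately have "eval2 F (Fract P Q) (Fract U Q) * to_fract Q ^ (m + n) =
    to_fract (\<Sum>x\<in>{..m} \<times> {..n}. smult (coeff (coeff F (snd x)) (fst x)) (hmonom m n P U Q x))"
    using Q by (subst eval2_hmonom) (auto simp: case_prod_beta)
  also have "(\<Sum>x\<in>{..m} \<times> {..n}. smult (coeff (coeff F (snd x)) (fst x)) (hmonom m n P U Q x)) =
    (\<Sum>x\<in>I. smult (coeff (coeff F (snd x)) (fst x)) (hmonom m n P U Q x))"
    using I by (intro sum.mono_neutral_right) force+
  finally show ?thesis
    using Q to_fract_eq_0_iff power_eq_0_iff no_zero_divisors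
    by (metis (no_types, lifting) mult_zero_left)
qed

section \<open>Clearing denominators\<close>

interpretation fract_poly_hom: map_poly_inj_idom_hom to_fract ..

lemma map_poly_hmonom:
  "map_poly to_fract (hmonom m n P U Q x) =
    hmonom m n (map_poly to_fract P) (map_poly to_fract U) (map_poly to_fract Q) x"
  by (cases x) (simp add: hmonom_def fract_poly_hom.hom_mult fract_poly_hom.hom_power)

lemma eval_coeffs_hmonom:
  "eval_coeffs z (hmonom m n P U Q x) =
    hmonom m n (eval_coeffs z P) (eval_coeffs z U) (eval_coeffs z Q) x"
  by (cases x) (simp add: hmonom_def eval_coeffs.hom_mult eval_coeffs.hom_power)

lemma ex_common_denominator:
  fixes S :: "'a::idom fract set"
  assumes "finite S"
  shows "\<exists>d. d \<noteq> 0 \<and> (\<forall>x\<in>S. \<exists>c. to_fract d * x = to_fract c)"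
  using assms
proof induction
  case empty
  show ?case
    by (rule exI[of _ 1]) simp
next
  case (insert x S)
  then obtain d where d: "d \<noteq> 0" "\<And>y. y \<in> S \<Longrightarrow> \<exists>c. to_fract d * y = to_fract c"
    by blast
  obtain a b where x: "x = Fract a b" "b \<noteq> 0"
    by (cases x) 
  have "\<exists>c. to_fract (d * b) * y = to_fract c" if "y \<in> insert x S" for y
  proof (cases "y = x")
    case True
    have "to_fract (d * b) * x = to_fract (d * a)"
      using x by (simp add: Fract_conv_to_fract)
    thus ?thesis
      using True by blast
  next
    case False
    hence "y \<in> S"
      using that by simp
    then obtain c where "to_fract d * y = to_fract c"
      using d(2) by blast
    hence "to_fract (d * b) * y = to_fract (c * b)"
      by (simp add: mult_ac)
    thus ?thesis
      by blast
  qed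
  thus ?case
    using d(1) x(2) by (intro exI[of _ "d * b"]) auto
qed

lemma ex_fract_poly_multiple:
  fixes p :: "'a::idom fract poly"
  assumes "\<And>i. \<exists>c. to_fract d * coeff p i = to_fract c"
  shows "\<exists>q. smult (to_fract d) p = map_poly to_fract q"
proof -
  obtain c where c: "\<And>i. to_fract d * coeff p i = to_fract (c i)"
    using assms by metis
  have "smult (to_fract d) p = map_poly to_fract (\<Sum>i\<le>degree p. monom (c i) i)"
  proof (rule poly_eqI)
    fix k
    have "c k = 0" if "k > degree p"
      using c[of k] that by (simp add: coeff_eq_0)
    thus "coeff (smult (to_fract d) p) k = coeff (map_poly to_fract (\<Sum>i\<le>degree p. monom (c i) i)) k"
      using c[of k] by (auto simp: coeff_map_poly coeff_sum not_le)
  qed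
  thus ?thesis
    by blast
qed

text \<open>Both elements get one denominator, as \<open>hmonom\<close> demands, and coefficients in
  the domain itself, so that values can be substituted for z.\<close>

lemma ex_integral_fractions:
  fixes r s :: "'a::idom fract poly fract"
  obtains P U Q where "Q \<noteq> 0" "r = Fract (map_poly to_fract P) (map_poly to_fract Q)"
    "s = Fract (map_poly to_fract U) (map_poly to_fract Q)"
proof -
  obtain p1 q1 where r: "r = Fract p1 q1" "q1 \<noteq> 0"
    by (cases r)
  obtain p2 q2 where s: "s = Fract p2 q2" "q2 \<noteq> 0"
    by (cases s)
  define p u q where "p = p1 * q2" and "u = p2 * q1" and "q = q1 * q2"
  have q: "q \<noteq> 0"
    using r s by (simp add: q_def)
  define S where "S = range (coeff p) \<union> range (coeff u) \<union> range (coeff q)"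
  have "finite S"
    by (simp add: S_def range_coeff)
  then obtain d where d: "d \<noteq> 0" "\<forall>x\<in>S. \<exists>c. to_fract d * x = to_fract c"
    using ex_common_denominator by blast
  obtain P where P: "smult (to_fract d) p = map_poly to_fract P"
    using ex_fract_poly_multiple[of d p] d(2) unfolding S_def by blast
  obtain U where U: "smult (to_fract d) u = map_poly to_fract U"
    using ex_fract_poly_multiple[of d u] d(2) unfolding S_def by blast
  obtain Q where Q: "smult (to_fract d) q = map_poly to_fract Q"
    using ex_fract_poly_multiple[of d q] d(2) unfolding S_def by blast
  have scale: "Fract (smult (to_fract d) a) (smult (to_fract d) q) = Fract a q" for a
    using d(1) q by (simp add: eq_fract)
  show ?thesis
  proof
    show nz: "Q \<noteq> 0"
    proof
      assume "Q = 0"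
      hence "smult (to_fract d) q = 0"
        using Q by simp
      thus False
        using d(1) q by simp
    qed
    show "r = Fract (map_poly to_fract P) (map_poly to_fract Q)"
      using r s d(1) unfolding P[symmetric] Q[symmetric] scale
      by (simp add: eq_fract p_def q_def)
    show "s = Fract (map_poly to_fract U) (map_poly to_fract Q)"
      using r s d(1) unfolding U[symmetric] Q[symmetric] scale
      by (simp add: eq_fract u_def q_def mult_ac)
  qed
qed

text \<open>The hypothesis on the kernel makes the polynomials \<open>hmonom\<close> indexed by
  \<open>I\<close> linearly independent over k[z]. They stay independent for almost every
  \<open>z\<close>, and this is the conclusion for the specialized point.\<close>

lemma eventually_kernel_specialization:
  fixes P U Q :: "'k::field poly poly"
  defines "r \<equiv> Fract (map_poly to_fract P) (map_poly to_fract Q)"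
    and "s \<equiv> Fract (map_poly to_fract U) (map_poly to_fract Q)"
  assumes Q: "Q \<noteq> 0" and I: "I \<subseteq> {..m} \<times> {..n}"
    and ker: "\<And>G. eval2 G r s = 0 \<Longrightarrow>
      (\<And>i j. coeff (coeff G j) i \<noteq> 0 \<Longrightarrow> (i, j) \<in> I) \<Longrightarrow> G = 0"
  shows "\<forall>\<^sub>\<infinity>z. \<forall>g. 
    eval2 g (Fract (eval_coeffs z P) (eval_coeffs z Q)) (Fract (eval_coeffs z U) (eval_coeffs z Q)) = 0
    \<longrightarrow> (\<forall>i j. coeff (coeff g j) i \<noteq> 0 \<longrightarrow> (i, j) \<in> I) \<longrightarrow> g = 0"
proof -
  have "finite I"
    using I finite_subset by blast
  have "\<forall>x\<in>I. c x = 0" if c: "(\<Sum>x\<in>I. smult (c x) (hmonom m n P U Q x)) = 0" for c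
  proof -
    \<comment> \<open>A relation with coefficients \<open>c\<close> becomes a polynomial supported
      in \<open>I\<close> that vanishes at (r, s).\<close>
    define G where "G = (\<Sum>x\<in>I. monom (monom (to_fract (c x)) (fst x)) (snd x))"
    have coeff_G: "coeff (coeff G j) i = (if (i, j) \<in> I then to_fract (c (i, j)) else 0)" for i j
    proof -
      have "coeff (coeff G j) i = (\<Sum>x\<in>I. if x = (i, j) then to_fract (c x) else 0)"
        unfolding G_def coeff_sum by (intro sum.cong) (auto simp: prod_eq_iff)
      thus ?thesis
        using \<open>finite I\<close> by simp
    qed
    have "(\<Sum>x\<in>I. smult (coeff (coeff G (snd x)) (fst x))
        (hmonom m n (map_poly to_fract P) (map_poly to_fract U) (map_poly to_fract Q) x)) =
      map_poly to_fract (\<Sum>x\<in>I. smult (c x) (hmonom m n P U Q x))"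
      by (simp add: fract_poly_hom.hom_sum hom_distribs coeff_G map_poly_hmonom)
    hence "eval2 G r s = 0"
      unfolding r_def s_def using I Q c coeff_G
      by (subst eval2_eq_0_iff_hmonom[of I m n]) (auto split: if_splits)
    hence "G = 0"
      by (rule ker) (simp add: coeff_G split: if_splits)
    thus ?thesis
      using coeff_G by (metis coeff_0 prod.collapse to_fract_eq_0_iff)
  qed
  from eventually_independent_eval_coeffs[OF \<open>finite I\<close> this]
  have "\<forall>\<^sub>\<infinity>z. \<forall>a. (\<Sum>x\<in>I. smult (a x) (eval_coeffs z (hmonom m n P U Q x))) = 0 \<longrightarrow>
     (\<forall>x\<in>I. a x = 0)" .
  moreover note eventually_eval_coeffs_neq_0[OF Q]
  ultimately show ?thesis
  proof eventually_elim
    case (elim z)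
    show ?case
    proof (intro allI impI)
      fix g
      assume 1: "eval2 g (Fract (eval_coeffs z P) (eval_coeffs z Q))
          (Fract (eval_coeffs z U) (eval_coeffs z Q)) = 0"
        and 2: "\<forall>i j. coeff (coeff g j) i \<noteq> 0 \<longrightarrow> (i, j) \<in> I"
      have "\<forall>x\<in>I. coeff (coeff g (snd x)) (fst x) = 0"
        using 1 2 elim I
        by (subst (asm) eval2_eq_0_iff_hmonom[of I m n]) (auto simp: eval_coeffs_hmonom)
      hence "coeff (coeff g j) i = 0" for i j
        using 2 by force
      thus "g = 0"
        by (intro poly_eqI) simp
    qed
  qed
qed

section \<open>Irreducibility of almost every specialized curve\<close>

lemma ratfun_eval_Fract:
  assumes "poly d z \<noteq> 0"
  shows "ratfun_eval z (Fract c d) = poly c z / poly d z"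
proof -
  obtain a b where ab: "quot_of_fract (Fract c d) = (a, b)"
    by fastforce
  have "b \<noteq> 0" "Fract c d = Fract a b"
    using ab by (metis snd_conv snd_quot_of_fract_nonzero, metis Fract_quot_of_fract fst_conv snd_conv)
  moreover have "d \<noteq> 0"
    using assms by auto
  ultimately have e: "c * b = a * d"
    by (simp add: eq_fract)
  \<comment> \<open>By cross-multiplication a zero of the reduced denominator would also be a zero
    of the reduced numerator, against coprimality.\<close>
  have "poly b z \<noteq> 0"
  proof
    assume "poly b z = 0"
    hence "poly a z = 0"
      using arg_cong[OF e, of "\<lambda>p. poly p z"] assms by simp
    moreover have "coprime a b"
      using coprime_quot_of_fract[of "Fract c d"] ab by simp
    ultimately show False
      using \<open>poly b z = 0\<close> coprime_poly_0[of a b z] by simp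
  qed
  thus ?thesis
    using arg_cong[OF e, of "\<lambda>p. poly p z"] assms ab
    by (simp add: ratfun_eval_def frac_eq_eq)
qed

lemma coeff_specialize: "coeff (coeff (specialize z F) j) i = ratfun_eval z (coeff (coeff F j) i)"
proof -
  have "ratfun_eval z 0 = 0"
    by (simp add: ratfun_eval_def)
  thus ?thesis
    by (simp add: specialize_def coeff_map_poly)
qed


text \<open>By the kernel statements for the supports \<open>I\<^sub>x\<close> and
  \<open>I\<^sub>y\<close>, a factor that vanishes at the specialized point has full degree in both
  variables; full degree in y alone would still allow a cofactor in x. The conclusion keeps the
  point because it parametrizes the curve in the computation of the genus.\<close>

theorem eventually_irreducible_specialize:
  fixes F :: "complex poly fract poly poly"
  assumes F: "irreducible F" "degree F > 0" "eval2 F r s = 0" and r: "deriv_fract r \<noteq> 0"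
  shows "\<forall>\<^sub>\<infinity>z. irreducible (specialize z F) \<and> degree (specialize z F) > 0 \<and>
    (\<exists>a b. eval2 (specialize z F) a b = 0 \<and> deriv_fract a \<noteq> 0)"
proof -
  obtain P U Q where Q: "Q \<noteq> 0"
    and r_eq: "r = Fract (map_poly to_fract P) (map_poly to_fract Q)"
    and s_eq: "s = Fract (map_poly to_fract U) (map_poly to_fract Q)"
    by (rule ex_integral_fractions)
  define m n where "m = degree_inner F" and "n = degree F"
  define I where "I = {..m} \<times> {..n}"
  define I\<^sub>x where "I\<^sub>x = {..<m} \<times> {..n}"
  define I\<^sub>y where "I\<^sub>y = {..m} \<times> {..<n}"
  define a where "a z = Fract (eval_coeffs z P) (eval_coeffs z Q)" for z
  define b where "b z = Fract (eval_coeffs z U) (eval_coeffs z Q)" for z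
  have F_nz: "F \<noteq> 0"
    using F(2) by auto

  have Q_nz: "\<forall>\<^sub>\<infinity>z. eval_coeffs z Q \<noteq> 0"
    by (rule eventually_eval_coeffs_neq_0[OF Q])

  \<comment> \<open>A nonzero multiple of \<open>F\<close> has degree at least \<open>n\<close> in
    y, so it is not supported in \<open>I\<^sub>y\<close>.\<close>
  have ker_y: "\<forall>\<^sub>\<infinity>z. \<forall>g. eval2 g (a z) (b z) = 0 \<longrightarrow>
      (\<forall>i j. coeff (coeff g j) i \<noteq> 0 \<longrightarrow> (i, j) \<in> I\<^sub>y) \<longrightarrow> g = 0"
    unfolding a_def b_def
  proof (rule eventually_kernel_specialization[OF Q])
    show "I\<^sub>y \<subseteq> {..m} \<times> {..n}"
      by (auto simp: I\<^sub>y_def)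
    fix G
    assume G: "eval2 G (Fract (map_poly to_fract P) (map_poly to_fract Q))
        (Fract (map_poly to_fract U) (map_poly to_fract Q)) = 0"
      and supp: "\<And>i j. coeff (coeff G j) i \<noteq> 0 \<Longrightarrow> (i, j) \<in> I\<^sub>y"
    show "G = 0"
    proof (rule ccontr)
      assume "G \<noteq> 0"
      moreover have "F dvd G"
        using irreducible_dvd_of_eval2_eq_0[OF F r, of G] G r_eq s_eq by simp
      ultimately have "n \<le> degree G"
        unfolding n_def by (simp add: dvd_imp_degree_le)
      moreover have "(degree (lead_coeff G), degree G) \<in> I\<^sub>y"
        using \<open>G \<noteq> 0\<close> by (intro supp) simp
      ultimately show False
        by (simp add: I\<^sub>y_def)
    qed
  qed

  have ker_x: "\<forall>\<^sub>\<infinity>z. \<forall>g. eval2 g (a z) (b z) = 0 \<longrightarrow>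
      (\<forall>i j. coeff (coeff g j) i \<noteq> 0 \<longrightarrow> (i, j) \<in> I\<^sub>x) \<longrightarrow> g = 0"
    unfolding a_def b_def
  proof (rule eventually_kernel_specialization[OF Q])
    show "I\<^sub>x \<subseteq> {..m} \<times> {..n}"
      by (auto simp: I\<^sub>x_def)
    fix G
    assume G: "eval2 G (Fract (map_poly to_fract P) (map_poly to_fract Q))
        (Fract (map_poly to_fract U) (map_poly to_fract Q)) = 0"
      and supp: "\<And>i j. coeff (coeff G j) i \<noteq> 0 \<Longrightarrow> (i, j) \<in> I\<^sub>x"
    show "G = 0"
    proof (rule ccontr)
      assume nz: "G \<noteq> 0"
      have "F dvd G"
        using irreducible_dvd_of_eval2_eq_0[OF F r, of G] G r_eq s_eq by simp
      then obtain H where "G = F * H"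
        by blast
      with nz have "m \<le> degree_inner G"
        using degree_inner_mult_ge[of F H] by (auto simp: m_def)
      then obtain j where j: "m \<le> degree (coeff G j)"
        using degree_inner_attained by metis
      \<comment> \<open>If \<open>coeff G j\<close> is zero then \<open>m = 0\<close> and
        \<open>I\<^sub>x\<close> is empty, which contradicts that \<open>G\<close> has a nonzero
        coefficient.\<close>
      have "\<exists>k. coeff (coeff G k) (degree (coeff G j)) \<noteq> 0"
      proof (cases "coeff G j = 0")
        case True
        hence "m = 0"
          using j by simp
        have "(degree (lead_coeff G), degree G) \<in> I\<^sub>x"
          using nz by (intro supp) simp
        thus ?thesis
          using \<open>m = 0\<close> by (simp add: I\<^sub>x_def)
      next
        case False
        thus ?thesis
          by (intro exI[of _ j]) simp
      qed
      then obtain k where "(degree (coeff G j), k) \<in> I\<^sub>x"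
        using supp by blast
      thus False
        using j by (simp add: I\<^sub>x_def)
    qed
  qed

  have a_nz: "\<forall>\<^sub>\<infinity>z. deriv_fract (a z) \<noteq> 0"
  proof -
    \<comment> \<open>This is the numerator of the derivative of \<open>r\<close> by the quotient
      rule. As a nonzero element of \<complex>[z][\<lambda>] it stays nonzero for almost every
      z.\<close>
    have "pderiv P * Q - P * pderiv Q \<noteq> 0"
    proof
      assume "pderiv P * Q - P * pderiv Q = 0"
      hence "map_poly to_fract (pderiv P * Q - P * pderiv Q) = 0"
        by simp
      hence "deriv_fract r = 0"
        using Q
        by (simp add: r_eq deriv_fract_Fract to_fract_hom.map_poly_pderiv fract_poly_hom.hom_minus
            Zero_fract_def eq_fract)
      thus False
        using r by simp
    qed
    from eventually_eval_coeffs_neq_0[OF this] Q_nz show ?thesis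
    proof eventually_elim
      case (elim z)
      have "pderiv (eval_coeffs z p) = eval_coeffs z (pderiv p)" for p
        by (rule poly_eqI) (simp add: coeff_pderiv)
      thus ?case
        using elim
        by (simp add: a_def deriv_fract_Fract eq_fract Zero_fract_def eval_coeffs.hom_minus
            eval_coeffs.hom_mult)
    qed
  qed

  have "finite ((\<lambda>(i, j). coeff (coeff F j) i) ` I)"
    by (simp add: I_def)
  then obtain d where d: "d \<noteq> 0"
    "\<forall>x\<in>(\<lambda>(i, j). coeff (coeff F j) i) ` I. \<exists>c. to_fract d * x = to_fract c"
    using ex_common_denominator by blast
  have "\<forall>x\<in>I. \<exists>c. to_fract d * coeff (coeff F (snd x)) (fst x) = to_fract c"
    using d(2) by (auto simp: image_iff)
  then obtain c where c: "\<And>x. x \<in> I \<Longrightarrow> to_fract d * coeff (coeff F (snd x)) (fst x) = to_fract (c x)"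
    by metis
  have coeff_F: "coeff (coeff F (snd x)) (fst x) = Fract (c x) d" if "x \<in> I" for x
    using c[OF that] d(1) by (simp add: Fract_conv_to_fract field_simps)
  have supp_F: "(i, j) \<in> I" if "coeff (coeff F j) i \<noteq> 0" for i j
  proof -
    have "i \<le> m"
      using that le_degree degree_coeff_le unfolding m_def by (metis order_trans)
    moreover have "j \<le> n"
      unfolding n_def using that by (intro le_degree) auto
    ultimately show ?thesis
      by (simp add: I_def)
  qed
  \<comment> \<open>With all denominators cleared, F(r, s) = 0 becomes an identity in
    \<complex>[z][\<lambda>], into which every value of z can be substituted.\<close>
  have F_sum: "(\<Sum>x\<in>I. smult (c x) (hmonom m n P U Q x)) = 0"
  proof -
    have "(\<Sum>x\<in>I. smult (coeff (coeff F (snd x)) (fst x))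
        (hmonom m n (map_poly to_fract P) (map_poly to_fract U) (map_poly to_fract Q) x)) = 0"
      using F(3) Q supp_F unfolding r_eq s_eq
      by (subst (asm) eval2_eq_0_iff_hmonom[of I m n]) (auto simp: I_def)
    hence "0 = smult (to_fract d) (\<Sum>x\<in>I. smult (coeff (coeff F (snd x)) (fst x))
        (map_poly to_fract (hmonom m n P U Q x)))"
      by (simp add: map_poly_hmonom)
    also have "\<dots> = (\<Sum>x\<in>I. smult (to_fract (c x)) (map_poly to_fract (hmonom m n P U Q x)))"
      unfolding smult_sum2 by (intro sum.cong) (simp_all add: c)
    also have "\<dots> = map_poly to_fract (\<Sum>x\<in>I. smult (c x) (hmonom m n P U Q x))"
      by (simp add: fract_poly_hom.hom_sum)
    finally show ?thesis
      by simp
  qed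

  have top: "(degree (lead_coeff F), n) \<in> I"
    using F_nz supp_F unfolding n_def by simp
  \<comment> \<open>This is the top coefficient of the leading coefficient of \<open>F\<close>
    without its denominator. As long as it is nonzero, the degree in y does not drop.\<close>
  have "\<forall>\<^sub>\<infinity>z. poly (c (degree (lead_coeff F), n)) z \<noteq> 0"
  proof (rule eventually_poly_neq_0)
    have "to_fract d * lead_coeff (lead_coeff F) \<noteq> 0"
      using F_nz d(1) by simp
    thus "c (degree (lead_coeff F), n) \<noteq> 0"
      using c[OF top] by (auto simp: n_def)
  qed
  moreover have "\<forall>\<^sub>\<infinity>z. poly d z \<noteq> 0"
    by (rule eventually_poly_neq_0[OF d(1)])
  moreover note Q_nz ker_x ker_y a_nz
  ultimately show ?thesis
  proof eventually_elim
    case (elim z)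
    note elim_top = elim(1) and elim_d = elim(2) and elim_Q = elim(3) and elim_x = elim(4)
      and elim_y = elim(5) and elim_a = elim(6)
    let ?f = "specialize z F"
    have coeff_f: "coeff (coeff ?f (snd x)) (fst x) = poly (c x) z / poly d z" if "x \<in> I" for x
      using that elim_d by (simp add: coeff_specialize coeff_F ratfun_eval_Fract)
    have supp_f: "(i, j) \<in> I" if "coeff (coeff ?f j) i \<noteq> 0" for i j
      using that supp_F[of j i] by (cases "coeff (coeff F j) i = 0")
        (auto simp: coeff_specialize ratfun_eval_def)
    have "(\<Sum>x\<in>I. smult (coeff (coeff ?f (snd x)) (fst x))
        (hmonom m n (eval_coeffs z P) (eval_coeffs z U) (eval_coeffs z Q) x)) =
      smult (1 / poly d z) (eval_coeffs z (\<Sum>x\<in>I. smult (c x) (hmonom m n P U Q x)))"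
      unfolding eval_coeffs.hom_sum smult_sum2
      by (intro sum.cong) (simp_all add: coeff_f eval_coeffs_hmonom)
    hence f_ker: "eval2 ?f (a z) (b z) = 0"
      unfolding a_def b_def using elim_Q supp_f F_sum
      by (subst eval2_eq_0_iff_hmonom[of I m n]) (auto simp: I_def)
    have f_nz: "coeff ?f n \<noteq> 0"
      using coeff_f[OF top] elim_top elim_d by auto
    have deg_f: "degree ?f \<le> n"
      using supp_f[of "degree ?f" "degree (lead_coeff ?f)"]
      by (cases "?f = 0") (auto simp: I_def)
    have inner_f: "degree_inner ?f \<le> m"
      unfolding degree_inner_le_iff
    proof
      fix j
      show "degree (coeff ?f j) \<le> m"
        using supp_f[of j "degree (coeff ?f j)"] by (cases "coeff ?f j = 0") (auto simp: I_def)
    qed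
    \<comment> \<open>Since \<open>g\<close> already uses up the degree bounds \<open>n\<close> and
      \<open>m\<close>, the cofactor \<open>h\<close> has degree 0 in both variables.\<close>
    have unit: "h dvd 1" if gh: "?f = g * h" and g: "eval2 g (a z) (b z) = 0" for g h
    proof -
      have nz: "g \<noteq> 0" "h \<noteq> 0"
        using gh f_nz by auto
      have 1: "degree g + degree h \<le> n"
        using deg_f nz unfolding gh by (simp add: degree_mult_eq)
      have 2: "degree_inner g + degree_inner h \<le> m"
        using inner_f degree_inner_mult_ge[OF nz] unfolding gh by simp
      have supp_g: "i \<le> degree_inner g \<and> j \<le> degree g" if "coeff (coeff g j) i \<noteq> 0" for i j
        using that by (metis coeff_0 le_degree degree_coeff_le order_trans)
      have "n \<le> degree g"
      proof (rule ccontr)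
        assume "\<not> n \<le> degree g"
        hence "\<forall>i j. coeff (coeff g j) i \<noteq> 0 \<longrightarrow> (i, j) \<in> I\<^sub>y"
          using supp_g 2 by (fastforce simp: I\<^sub>y_def)
        thus False
          using elim_y g nz by blast
      qed
      moreover have "m \<le> degree_inner g"
      proof (rule ccontr)
        assume "\<not> m \<le> degree_inner g"
        hence "\<forall>i j. coeff (coeff g j) i \<noteq> 0 \<longrightarrow> (i, j) \<in> I\<^sub>x"
          using supp_g 1 by (fastforce simp: I\<^sub>x_def)
        thus False
          using elim_x g nz by blast
      qed
      ultimately have "degree h = 0" "degree_inner h = 0"
        using 1 2 by simp_all
      then obtain h' where h': "h = [:h':]"
        by (auto elim: degree_eq_zeroE)
      have "degree h' = 0"
        using degree_coeff_le[of h 0] \<open>degree_inner h = 0\<close> by (simp add: h')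
      then obtain h'' where "h' = [:h'':]"
        by (auto elim: degree_eq_zeroE)
      thus ?thesis
        using nz(2) h' by (simp add: is_unit_const_poly_iff)
    qed
    have deg_pos: "degree ?f > 0"
      using f_nz F(2) le_degree[of ?f n] by (simp add: n_def)
    have "irreducible ?f"
    proof (rule irreducibleI)
      show "?f \<noteq> 0"
        using f_nz by auto
      show "\<not> ?f dvd 1"
        using deg_pos by (simp add: poly_dvd_1)
      fix g h assume gh: "?f = g * h"
      \<comment> \<open>As \<complex>(\<lambda>) is a field, one of the factors vanishes at the
        specialized point, and then the other one is a unit.\<close>
      hence "eval2 g (a z) (b z) * eval2 h (a z) (b z) = 0"
        using f_ker by (simp add: eval2.hom_mult)
      thus "g dvd 1 \<or> h dvd 1"
        using unit[OF gh] unit[of h g] gh by (auto simp: mult.commute)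
    qed
    thus ?case
      using deg_pos f_ker elim_a by blast
  qed
qed

subsection \<open>The places of the rational function field\<close>

text \<open>
  The last axiom says that the residue field is \<open>k\<close>: \<open>a - c\<close> lies in the maximal ideal for some
  constant \<open>c\<close>. Its first alternative is needed since \<open>inverse 0 = 0\<close>.
\<close>

locale rational_place =
  fixes W :: "'k::field poly fract set"
  assumes const_mem: "const_fract c \<in> W"
    and add_mem: "a \<in> W \<Longrightarrow> b \<in> W \<Longrightarrow> a + b \<in> W"
    and mult_mem: "a \<in> W \<Longrightarrow> b \<in> W \<Longrightarrow> a * b \<in> W"
    and inverse_mem: "a \<notin> W \<Longrightarrow> inverse a \<in> W"
    and residue: "a \<in> W \<Longrightarrow> \<exists>c. a = const_fract c \<or> inverse (a - const_fract c) \<notin> W"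
begin

lemma zero_mem: "0 \<in> W" and one_mem: "1 \<in> W"
  using const_mem[of 0] const_mem[of 1] by simp_all

lemma uminus_mem: "a \<in> W \<Longrightarrow> - a \<in> W"
  using mult_mem[OF const_mem[of "- 1"], of a] by (simp add: const_fract.hom_uminus)

end

section \<open>The finite places\<close>

definition local_ring_at :: "'k::field \<Rightarrow> 'k poly fract set" where
  "local_ring_at c = {Fract p q | p q. poly q c \<noteq> 0}"

lemma Fract_mem_local_ring_at: "poly q c \<noteq> 0 \<Longrightarrow> Fract p q \<in> local_ring_at c"
  by (auto simp: local_ring_at_def)

lemma Fract_notin_local_ring_at:
  assumes "poly p c \<noteq> 0" "poly q c = 0" "q \<noteq> 0"
  shows "Fract p q \<notin> local_ring_at c"
proof
  assume "Fract p q \<in> local_ring_at c"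
  then obtain p' q' where eq: "Fract p q = Fract p' q'" and q': "poly q' c \<noteq> 0"
    by (auto simp: local_ring_at_def)
  have "q' \<noteq> 0"
    using q' by auto
  hence "p * q' = p' * q"
    using eq assms(3) by (simp add: eq_fract)
  from arg_cong[OF this, of "\<lambda>p. poly p c"] show False
    using assms q' by simp
qed

lemma Fract_diff_const: "q \<noteq> 0 \<Longrightarrow> Fract p q - const_fract c = Fract (p - smult c q) q"
  by (simp add: const_fract_def to_fract_def)

lemma rational_place_local_ring_at:
  fixes c :: "'k::field_gcd"
  shows "rational_place (local_ring_at c)"
proof
  show "const_fract d \<in> local_ring_at c" for d
    unfolding const_fract_def to_fract_def by (rule Fract_mem_local_ring_at) simp
  fix a :: "'k poly fract"
  show "a + b \<in> local_ring_at c" "a * b \<in> local_ring_at c"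
    if ab: "a \<in> local_ring_at c" "b \<in> local_ring_at c" for b
  proof -
    obtain p q p' q' where *: "a = Fract p q" "b = Fract p' q'" "poly q c \<noteq> 0" "poly q' c \<noteq> 0"
      using ab by (auto simp: local_ring_at_def)
    have "q \<noteq> 0" "q' \<noteq> 0" "poly (q * q') c \<noteq> 0"
      using * by auto
    thus "a + b \<in> local_ring_at c" "a * b \<in> local_ring_at c"
      using * by (simp_all add: Fract_mem_local_ring_at)
  qed
  show "inverse a \<in> local_ring_at c" if "a \<notin> local_ring_at c"
  proof -
    define p q where "p = fst (quot_of_fract a)" and "q = snd (quot_of_fract a)"
    have a: "a = Fract p q" and coprime: "Rings.coprime p q"
      by (simp_all add: p_def q_def coprime_quot_of_fract)
    have "poly q c = 0"
      using that Fract_mem_local_ring_at a by blast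
    hence "poly p c \<noteq> 0"
      using coprime_poly_0[OF coprime, of c] by simp
    thus ?thesis
      using Fract_mem_local_ring_at by (simp add: a)
  qed
  show "\<exists>d. a = const_fract d \<or> inverse (a - const_fract d) \<notin> local_ring_at c"
    if mem: "a \<in> local_ring_at c"
  proof -
    obtain p q where a: "a = Fract p q" "poly q c \<noteq> 0"
      using mem by (auto simp: local_ring_at_def)
    hence q: "q \<noteq> 0"
      by auto
    \<comment> \<open>The residue of \<open>a\<close> is its value at \<open>c\<close>.\<close>
    define d where "d = poly p c / poly q c"
    define n where "n = p - smult d q"
    have diff: "a - const_fract d = Fract n q"
      using q by (simp add: a n_def Fract_diff_const)
    show ?thesis
    proof (cases "n = 0")
      case True
      hence "a - const_fract d = 0"
        by (simp add: diff eq_fract Zero_fract_def q)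
      thus ?thesis
        by auto
    next
      case False
      moreover have "poly n c = 0"
        using a(2) by (simp add: n_def d_def)
      ultimately have "inverse (a - const_fract d) \<notin> local_ring_at c"
        using a(2) by (simp add: diff Fract_notin_local_ring_at)
      thus ?thesis
        by blast
    qed
  qed
qed

text \<open>At a finite point \<lambda> - c is a local parameter, so du is a multiple of d\<lambda>
  by an element of the same local ring.\<close>

lemma deriv_fract_local_ring_at:
  assumes "a \<in> local_ring_at c"
  shows "deriv_fract a \<in> local_ring_at c"
proof -
  obtain p q where a: "a = Fract p q" "poly q c \<noteq> 0"
    using assms by (auto simp: local_ring_at_def)
  hence "q \<noteq> 0"
    by auto
  thus ?thesis
    using a by (simp add: deriv_fract_Fract Fract_mem_local_ring_at)
qed

section \<open>The place at infinity\<close>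

text \<open>The case \<open>n = 0\<close> is the local ring at infinity.\<close>

definition vanishing_at_infinity :: "nat \<Rightarrow> 'k::field poly fract set" where
  "vanishing_at_infinity n = {Fract p q | p q. q \<noteq> 0 \<and> (p = 0 \<or> degree p + n \<le> degree q)}"

lemma Fract_mem_vanishing_at_infinity:
  "q \<noteq> 0 \<Longrightarrow> p = 0 \<or> degree p + n \<le> degree q \<Longrightarrow> Fract p q \<in> vanishing_at_infinity n"
  by (auto simp: vanishing_at_infinity_def)

lemma Fract_mem_vanishing_at_infinity_iff:
  assumes "q \<noteq> 0"
  shows "Fract p q \<in> vanishing_at_infinity n \<longleftrightarrow> p = 0 \<or> degree p + n \<le> degree q"
proof
  assume "Fract p q \<in> vanishing_at_infinity n"
  then obtain p' q' where *: "Fract p q = Fract p' q'" "q' \<noteq> 0" "p' = 0 \<or> degree p' + n \<le> degree q'"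
    by (auto simp: vanishing_at_infinity_def)
  hence eq: "p * q' = p' * q"
    using assms by (simp add: eq_fract)
  show "p = 0 \<or> degree p + n \<le> degree q"
  proof (cases "p = 0")
    case False
    hence "p' \<noteq> 0"
      using eq * by auto
    hence "degree p + degree q' = degree p' + degree q"
      using arg_cong[OF eq, of degree] False assms * by (simp add: degree_mult_eq)
    thus ?thesis
      using * \<open>p' \<noteq> 0\<close> by simp
  qed simp
qed (use assms in \<open>auto intro: Fract_mem_vanishing_at_infinity\<close>)

lemma zero_mem_vanishing_at_infinity: "0 \<in> vanishing_at_infinity n"
  unfolding Zero_fract_def by (rule Fract_mem_vanishing_at_infinity) simp_all

lemma add_mem_vanishing_at_infinity:
  assumes "a \<in> vanishing_at_infinity n" "b \<in> vanishing_at_infinity n"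
  shows "a + b \<in> vanishing_at_infinity n"
proof -
  obtain p q p' q' where *: "a = Fract p q" "b = Fract p' q'" "q \<noteq> 0" "q' \<noteq> 0"
    "p = 0 \<or> degree p + n \<le> degree q" "p' = 0 \<or> degree p' + n \<le> degree q'"
    using assms by (auto simp: vanishing_at_infinity_def)
  show ?thesis
  proof (cases "p = 0 \<or> p' = 0")
    case True
    hence "a + b = b \<or> a + b = a"
      using * by (auto simp: Zero_fract_def[symmetric] eq_fract add_fract)
    thus ?thesis
      using assms by auto
  next
    case False
    have "degree (p * q' + p' * q) \<le> max (degree (p * q')) (degree (p' * q))"
      by (rule degree_add_le_max)
    hence "degree (p * q' + p' * q) + n \<le> degree (q * q')"
      using * False by (auto simp: degree_mult_eq max_def split: if_splits)
    thus ?thesis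
      using * by (simp add: Fract_mem_vanishing_at_infinity)
  qed
qed

lemma mult_mem_vanishing_at_infinity:
  assumes "a \<in> vanishing_at_infinity m" "b \<in> vanishing_at_infinity n"
  shows "a * b \<in> vanishing_at_infinity (m + n)"
proof -
  obtain p q p' q' where *: "a = Fract p q" "b = Fract p' q'" "q \<noteq> 0" "q' \<noteq> 0"
    "p = 0 \<or> degree p + m \<le> degree q" "p' = 0 \<or> degree p' + n \<le> degree q'"
    using assms by (auto simp: vanishing_at_infinity_def)
  have "p * p' = 0 \<or> degree (p * p') + (m + n) \<le> degree (q * q')"
    using * degree_mult_le[of p p'] by (auto simp: degree_mult_eq)
  thus ?thesis
    using * by (simp add: Fract_mem_vanishing_at_infinity)
qed

lemma residue_at_infinity:
  assumes "a \<in> vanishing_at_infinity 0"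
  obtains c n q where "a - const_fract c = Fract n q" "q \<noteq> 0" "n = 0 \<or> degree n < degree q"
proof -
  obtain p q where a: "a = Fract p q" "q \<noteq> 0" "degree p \<le> degree q"
    using assms by (auto simp: vanishing_at_infinity_def)
  \<comment> \<open>The value at infinity; the coefficient is zero if \<open>p\<close> has smaller
    degree than \<open>q\<close>.\<close>
  define c where "c = coeff p (degree q) / lead_coeff q"
  define n where "n = p - smult c q"
  show ?thesis
  proof
    show "a - const_fract c = Fract n q"
      using a by (simp add: n_def Fract_diff_const)
    have "degree n \<le> degree q"
      using a(3) degree_smult_le[of c q] unfolding n_def by (intro degree_diff_le) auto
    moreover have "coeff n (degree q) = 0"
      using a(2) by (simp add: n_def c_def)
    ultimately show "n = 0 \<or> degree n < degree q"
      by (metis le_neq_implies_less leading_coeff_0_iff)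
  qed (fact a(2))
qed

lemma rational_place_vanishing_at_infinity:
  "rational_place (vanishing_at_infinity 0 :: 'k::field poly fract set)"
proof
  show "const_fract d \<in> vanishing_at_infinity 0" for d :: 'k
    unfolding const_fract_def to_fract_def by (rule Fract_mem_vanishing_at_infinity) simp_all
  fix a :: "'k poly fract"
  show "a + b \<in> vanishing_at_infinity 0" "a * b \<in> vanishing_at_infinity 0"
    if "a \<in> vanishing_at_infinity 0" "b \<in> vanishing_at_infinity 0" for b
    using that add_mem_vanishing_at_infinity[of a 0 b] mult_mem_vanishing_at_infinity[of a 0 b 0]
    by simp_all
  show "inverse a \<in> vanishing_at_infinity 0" if "a \<notin> vanishing_at_infinity 0"
  proof -
    obtain p q where a: "a = Fract p q" "q \<noteq> 0"
      by (cases a)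
    hence "p \<noteq> 0" "degree q \<le> degree p"
      using that by (auto simp: Fract_mem_vanishing_at_infinity_iff)
    thus ?thesis
      by (simp add: a Fract_mem_vanishing_at_infinity)
  qed
  show "\<exists>c. a = const_fract c \<or> inverse (a - const_fract c) \<notin> vanishing_at_infinity 0"
    if mem: "a \<in> vanishing_at_infinity 0"
  proof -
    obtain c n q where c: "a - const_fract c = Fract n q" "q \<noteq> 0" "n = 0 \<or> degree n < degree q"
      using residue_at_infinity[OF mem] .
    show ?thesis
    proof (cases "n = 0")
      case True
      hence "a - const_fract c = 0"
        using c by (simp add: eq_fract Zero_fract_def)
      thus ?thesis
        by auto
    next
      case False
      hence "inverse (a - const_fract c) \<notin> vanishing_at_infinity 0"
        using c by (simp add: Fract_mem_vanishing_at_infinity_iff)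
      thus ?thesis
        by blast
    qed
  qed
qed

text \<open>Since d\<lambda> has a double pole at infinity, u' must vanish there to order 2 when du
  = u' d\<lambda> is regular. Once the value at infinity is subtracted, the numerator has smaller
  degree than the denominator and the quotient rule gives the bound.\<close>

lemma deriv_fract_vanishing_at_infinity:
  fixes a :: "'k::field_char_0 poly fract"
  assumes "a \<in> vanishing_at_infinity 0"
  shows "deriv_fract a \<in> vanishing_at_infinity 2"
proof -
  obtain c n q where c: "a - const_fract c = Fract n q" "q \<noteq> 0" "n = 0 \<or> degree n < degree q"
    using residue_at_infinity[OF assms] .
  have "a = Fract n q + const_fract c"
    using c(1) by (metis diff_add_cancel)
  hence "deriv_fract a = Fract (pderiv n * q - n * pderiv q) (q\<^sup>2)"
    using c(2) by (simp add: deriv_fract_add deriv_fract_Fract)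
  also have "\<dots> \<in> vanishing_at_infinity 2"
  proof (rule Fract_mem_vanishing_at_infinity)
    show "pderiv n * q - n * pderiv q = 0 \<or>
      degree (pderiv n * q - n * pderiv q) + 2 \<le> degree (q\<^sup>2)"
    proof (cases "n = 0")
      case False
      hence deg: "degree n < degree q"
        using c(3) by simp
      have "degree (pderiv n * q) \<le> 2 * degree q - 2"
      \<comment> \<open>For constant \<open>n\<close> the bound
        \<open>degree (pderiv n) + degree q\<close> is too weak, because the degree of the
        derivative cannot drop below 0.\<close>
      proof (cases "degree n = 0")
        case True
        hence "pderiv n = 0"
          by (simp add: pderiv_eq_0_iff)
        thus ?thesis
          by simp
      next
        case False
        have "degree (pderiv n * q) \<le> degree (pderiv n) + degree q"
          by (rule degree_mult_le)
        thus ?thesis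
          using False deg by (simp add: degree_pderiv)
      qed
      moreover have "degree (n * pderiv q) \<le> 2 * degree q - 2"
      proof -
        have "degree (n * pderiv q) \<le> degree n + degree (pderiv q)"
          by (rule degree_mult_le)
        thus ?thesis
          using deg by (simp add: degree_pderiv)
      qed
      ultimately have "degree (pderiv n * q - n * pderiv q) \<le> 2 * degree q - 2"
        by (rule degree_diff_le)
      moreover have "degree (q\<^sup>2) = 2 * degree q"
        using c(2) by (simp add: degree_power_eq)
      ultimately show ?thesis
        using deg by linarith
    qed simp
  qed (use c in simp)
  finally show ?thesis .
qed

text \<open>A reduced denominator without complex roots is constant, and a nonzero polynomial does
  not vanish at infinity. Read for g d\<lambda>, this says that the projective line has no nonzero
  regular differential.\<close>

lemma eq_0_if_no_poles:
  fixes g :: "complex poly fract"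
  assumes "\<And>c. g \<in> local_ring_at c" "g \<in> vanishing_at_infinity 2"
  shows "g = 0"
proof -
  define p q where "p = fst (quot_of_fract g)" and "q = snd (quot_of_fract g)"
  have g: "g = Fract p q" and q: "q \<noteq> 0" and coprime: "Rings.coprime p q"
    by (simp_all add: p_def q_def coprime_quot_of_fract)
  have "degree q = 0"
  proof (rule ccontr)
    assume "degree q \<noteq> 0"
    then obtain c where c: "poly q c = 0"
      using alg_closed_imp_poly_has_root[of q] by auto
    hence "poly p c \<noteq> 0"
      using coprime_poly_0[OF coprime, of c] by simp
    thus False
      using Fract_notin_local_ring_at[OF _ c q] assms(1) g by blast
  qed
  hence "p = 0"
    using assms(2) q by (simp add: g Fract_mem_vanishing_at_infinity_iff)
  thus ?thesis
    by (simp add: g eq_fract Zero_fract_def q)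
qed

subsection \<open>Regular differentials\<close>

text \<open>The embedding \<open>\<psi>\<close> is a parametrization of the curve by the
  \<lambda>-line. It need not be onto: the line may cover the curve several times. The element
  \<open>x\<close> witnesses that the parametrization is not constant.\<close>

locale rational_embedding = K?: field K for K (structure) +
  fixes k :: "'a set" and \<psi> :: "'a \<Rightarrow> complex poly fract" and x :: 'a
  assumes hom_add: "u \<in> carrier K \<Longrightarrow> v \<in> carrier K \<Longrightarrow> \<psi> (u \<oplus> v) = \<psi> u + \<psi> v"
    and hom_mult: "u \<in> carrier K \<Longrightarrow> v \<in> carrier K \<Longrightarrow> \<psi> (u \<otimes> v) = \<psi> u * \<psi> v"
    and hom_one: "\<psi> \<one> = 1"
    and inj: "inj_on \<psi> (carrier K)"
    and k_subset: "k \<subseteq> carrier K"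
    and image_k: "\<psi> ` k = range const_fract"
    and x: "x \<in> carrier K" "deriv_fract (\<psi> x) \<noteq> 0"
begin

lemma hom_zero: "\<psi> \<zero> = 0"
  using hom_add[of \<zero> \<zero>] by (metis add_cancel_right_right l_zero zero_closed)

lemma hom_uminus: "u \<in> carrier K \<Longrightarrow> \<psi> (\<ominus> u) = - \<psi> u"
  using hom_add[of u "\<ominus> u"] by (simp add: r_neg hom_zero eq_neg_iff_add_eq_0 add.commute)

lemma hom_minus: "u \<in> carrier K \<Longrightarrow> v \<in> carrier K \<Longrightarrow> \<psi> (u \<ominus> v) = \<psi> u - \<psi> v"
  by (simp add: a_minus_def hom_add hom_uminus)

lemma hom_eq_0_iff: "u \<in> carrier K \<Longrightarrow> \<psi> u = 0 \<longleftrightarrow> u = \<zero>"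
  using inj hom_zero by (metis inj_on_eq_iff zero_closed)

lemma hom_inv: 
  assumes "u \<in> carrier K" "u \<noteq> \<zero>"
  shows "\<psi> (inv u) = inverse (\<psi> u)"
proof -
  have "u \<in> Units K"
    using assms by (simp add: field_Units)
  hence "\<psi> u * \<psi> (inv u) = 1"
    using assms by (metis Units_inv_closed Units_r_inv hom_mult hom_one)
  thus ?thesis
    by (metis inverse_unique)
qed

lemma inv_mem: "u \<in> carrier K \<Longrightarrow> u \<noteq> \<zero> \<Longrightarrow> inv u \<in> carrier K"
  by (simp add: field_Units)

lemma mem_k_iff: "u \<in> carrier K \<Longrightarrow> u \<in> k \<longleftrightarrow> \<psi> u \<in> range const_fract"
  using inj k_subset image_k by (metis image_eqI inj_on_image_mem_iff)

lemma subfield_k: "subfield k K"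
proof (rule subfieldI'[OF subringI])
  show "k \<subseteq> carrier K"
    by (rule k_subset)
  show "\<one> \<in> k"
    by (auto simp: mem_k_iff hom_one intro!: range_eqI[of _ _ 1])
  fix u assume u: "u \<in> k"
  then obtain c where c: "\<psi> u = const_fract c"
    using image_k by (metis imageI rangeE)
  have u': "u \<in> carrier K"
    using u k_subset by auto
  show "\<ominus> u \<in> k"
    using u' c by (auto simp: mem_k_iff hom_uminus const_fract.hom_uminus intro!: range_eqI[of _ _ "- c"])
  fix v assume v: "v \<in> k"
  then obtain d where d: "\<psi> v = const_fract d"
    using image_k by (metis imageI rangeE)
  have v': "v \<in> carrier K"
    using v k_subset by auto
  show "u \<otimes> v \<in> k"
    using u' v' c d by (auto simp: mem_k_iff hom_mult const_fract.hom_mult intro!: range_eqI[of _ _ "c * d"])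
  show "u \<oplus> v \<in> k"
    using u' v' c d by (auto simp: mem_k_iff hom_add const_fract.hom_add intro!: range_eqI[of _ _ "c + d"])
next
  fix u assume u: "u \<in> k - {\<zero>}"
  then obtain c where c: "\<psi> u = const_fract c"
    using image_k by (metis DiffD1 imageI rangeE)
  have u': "u \<in> carrier K" "u \<noteq> \<zero>"
    using u k_subset by auto
  hence "c \<noteq> 0"
    using c hom_eq_0_iff by auto
  hence "inverse (const_fract c) = const_fract (inverse c)"
    by (intro inverse_unique) (simp flip: const_fract.hom_mult)
  thus "inv u \<in> k"
    using u' c by (auto simp: mem_k_iff hom_inv inv_mem)
qed

text \<open>For a place W of \<complex>(\<lambda>) this is the place of K below it, the image on the
  curve of a point of the \<lambda>-line.\<close>

definition pullback :: "complex poly fract set \<Rightarrow> 'a set" where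
  "pullback W = {u \<in> carrier K. \<psi> u \<in> W}"

lemma pullback_mem_places:
  assumes "rational_place W"
  shows "pullback W \<in> places K k"
proof -
  interpret W: rational_place W
    by fact
  have "subring (pullback W) K"
    by (rule subringI) (auto simp: pullback_def hom_add hom_mult hom_one hom_uminus
        W.add_mem W.mult_mem W.one_mem W.uminus_mem)
  moreover have "k \<subseteq> pullback W"
  proof
    fix u assume "u \<in> k"
    hence "\<psi> u \<in> range const_fract" "u \<in> carrier K"
      using image_k k_subset by auto
    thus "u \<in> pullback W"
      using W.const_mem by (auto simp: pullback_def)
  qed
  moreover have "inv u \<in> pullback W" if "u \<in> carrier K" "u \<notin> pullback W" for u
  proof -
    have "u \<noteq> \<zero>"
      using that W.zero_mem by (auto simp: pullback_def hom_zero)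
    thus ?thesis
      using that by (simp add: pullback_def hom_inv inv_mem W.inverse_mem)
  qed
  \<comment> \<open>The element outside is \<open>x\<close> itself if it has a pole at W, and
    otherwise the inverse of \<open>x\<close> minus its residue.\<close>
  moreover have "pullback W \<noteq> carrier K"
  proof (cases "\<psi> x \<in> W")
    case False
    thus ?thesis
      using x by (auto simp: pullback_def)
  next
    case True
    then obtain c where c: "\<psi> x = const_fract c \<or> inverse (\<psi> x - const_fract c) \<notin> W"
      using W.residue by blast
    moreover have "\<psi> x \<noteq> const_fract c"
      using x(2) by auto
    moreover obtain y where y: "y \<in> k" "\<psi> y = const_fract c"
      using image_k by (metis rangeI imageE)
    ultimately have "\<psi> (x \<ominus> y) \<noteq> 0" "inverse (\<psi> (x \<ominus> y)) \<notin> W"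
      using k_subset x by (auto simp: hom_minus)
    moreover have "x \<ominus> y \<in> carrier K"
      using x y k_subset by auto
    moreover from calculation have "x \<ominus> y \<noteq> \<zero>"
      using hom_zero by metis
    ultimately have "inv (x \<ominus> y) \<in> carrier K" "inv (x \<ominus> y) \<notin> pullback W"
      by (auto simp: pullback_def hom_inv hom_zero inv_mem)
    thus ?thesis
      by blast
  qed
  ultimately show ?thesis
    by (auto simp: places_def)
qed

abbreviation "\<Omega> \<equiv> differential_space K k"

lemma carrier_\<Omega>: "carrier \<Omega> = derivations K k \<rightarrow>\<^sub>E carrier K"
  by (simp add: func_space_def)

lemma module_over_subring:
  assumes "subring S K"
  shows "module (K\<lparr>carrier := S\<rparr>) \<Omega>"
proof -
  interpret M: module K \<Omega>
    by (rule func_space_is_module)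
  have S: "S \<subseteq> carrier K"
    by (rule subringE(1)[OF assms])
  show ?thesis
  proof (rule moduleI)
    show "cring (K\<lparr>carrier := S\<rparr>)"
      using subcring_iff[OF S] subcringI'[OF assms] by blast
    show "abelian_group \<Omega>"
      by (rule M.abelian_group_axioms)
  qed (use S in \<open>auto simp: subset_iff M.smult_l_distr M.smult_r_distr M.smult_assoc1\<close>)
qed

lemma differential_mem: "u \<in> carrier K \<Longrightarrow> differential K k u \<in> carrier \<Omega>"
  unfolding differential_def carrier_\<Omega>
  by (intro restrict_PiE_iff[THEN iffD2]) (auto simp: derivations_def)

lemma zero_mem_differentials_over:
  assumes "subring S K"
  shows "\<zero>\<^bsub>\<Omega>\<^esub> \<in> differentials_over K k S"
proof -
  interpret module "K\<lparr>carrier := S\<rparr>" \<Omega>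
    by (rule module_over_subring) fact
  have "LinearCombinations.submodule (K\<lparr>carrier := S\<rparr>) (differentials_over K k S) \<Omega>"
    unfolding differentials_over_def
    using subringE(1)[OF assms] differential_mem by (intro span_is_submodule) auto
  thus ?thesis
    by (rule LinearCombinations.submodule.zero_closed)
qed

text \<open>Here \<open>W'\<close> stands for the g such that g d\<lambda> is regular at W, and
  \<open>\<delta>\<close> acts as t times d/d\<lambda>. The differentials whose value at
  \<open>\<delta>\<close> is t g with g in \<open>W'\<close> form a module over the pulled back
  local ring. This module contains du for every u in that ring, hence all differentials regular at
  the place.\<close>

lemma regular_differential_pullback:
  assumes W: "rational_place W"
    and W': "0 \<in> W'" "\<And>a b. a \<in> W' \<Longrightarrow> b \<in> W' \<Longrightarrow> a + b \<in> W'"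
      "\<And>a b. a \<in> W \<Longrightarrow> b \<in> W' \<Longrightarrow> a * b \<in> W'" "\<And>a. a \<in> W \<Longrightarrow> deriv_fract a \<in> W'"
    and \<omega>: "\<omega> \<in> regular_differentials K k" and \<delta>: "\<delta> \<in> derivations K k"
    and t: "\<And>u. u \<in> carrier K \<Longrightarrow> \<psi> (\<delta> u) = t * deriv_fract (\<psi> u)"
  shows "\<exists>g\<in>W'. \<psi> (\<omega> \<delta>) = t * g"
proof -
  interpret W: rational_place W
    by fact
  let ?V = "pullback W"
  have place: "?V \<in> places K k"
    by (rule pullback_mem_places) fact
  hence V: "subring ?V K" "?V \<subseteq> carrier K"
    by (auto simp: places_def pullback_def)
  interpret M: module "K\<lparr>carrier := ?V\<rparr>" \<Omega>
    by (rule module_over_subring) fact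
  define N where "N = {\<omega> \<in> carrier \<Omega>. \<exists>g\<in>W'. \<psi> (\<omega> \<delta>) = t * g}"
  have "LinearCombinations.submodule (K\<lparr>carrier := ?V\<rparr>) N \<Omega>"
  proof
    show "N \<subseteq> carrier \<Omega>"
      by (auto simp: N_def)
    show "\<zero>\<^bsub>\<Omega>\<^esub> \<in> N"
      using \<delta> W'(1) by (auto simp: N_def func_space_def hom_zero)
    show "v \<oplus>\<^bsub>\<Omega>\<^esub> w \<in> N" if vw: "v \<in> N" "w \<in> N" for v w
    proof -
      obtain g h where gh: "g \<in> W'" "\<psi> (v \<delta>) = t * g" "h \<in> W'" "\<psi> (w \<delta>) = t * h"
        using vw unfolding N_def by blast
      have "v \<in> carrier \<Omega>" "w \<in> carrier \<Omega>"
        using vw by (auto simp: N_def)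
      moreover from this have "v \<delta> \<in> carrier K" "w \<delta> \<in> carrier K"
        using \<delta> by (auto simp: carrier_\<Omega>)
      ultimately have "v \<oplus>\<^bsub>\<Omega>\<^esub> w \<in> carrier \<Omega>" "\<psi> ((v \<oplus>\<^bsub>\<Omega>\<^esub> w) \<delta>) = t * (g + h)"
        using \<delta> gh by (auto simp: func_space_def hom_add distrib_left)
      thus ?thesis
        using W'(2) gh by (auto simp: N_def)
    qed
    show "c \<odot>\<^bsub>\<Omega>\<^esub> v \<in> N" if "c \<in> carrier (K\<lparr>carrier := ?V\<rparr>)" "v \<in> N" for c v
    proof -
      have c: "c \<in> carrier K" "\<psi> c \<in> W"
        using that by (auto simp: pullback_def)
      obtain g where g: "g \<in> W'" "\<psi> (v \<delta>) = t * g"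
        using \<open>v \<in> N\<close> unfolding N_def by blast
      have "v \<in> carrier \<Omega>"
        using that by (auto simp: N_def)
      moreover from this have "v \<delta> \<in> carrier K"
        using \<delta> by (auto simp: carrier_\<Omega>)
      ultimately have "c \<odot>\<^bsub>\<Omega>\<^esub> v \<in> carrier \<Omega>" "\<psi> ((c \<odot>\<^bsub>\<Omega>\<^esub> v) \<delta>) = t * (\<psi> c * g)"
        using \<delta> g c by (auto simp: func_space_def hom_mult)
      thus ?thesis
        using W'(3) g c by (auto simp: N_def)
    qed
  qed
  moreover have "differential K k ` ?V \<subseteq> N"
  proof
    fix \<eta> assume "\<eta> \<in> differential K k ` ?V"
    then obtain u where u: "u \<in> carrier K" "\<psi> u \<in> W" "\<eta> = differential K k u"
      by (auto simp: pullback_def)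
    hence "\<psi> (\<eta> \<delta>) = t * deriv_fract (\<psi> u)"
      using \<delta> t by (simp add: differential_def)
    thus "\<eta> \<in> N"
      using u differential_mem W'(4) by (auto simp: N_def)
  qed
  ultimately have "differentials_over K k ?V \<subseteq> N"
    unfolding differentials_over_def by (intro M.span_is_subset)
  thus ?thesis
    using \<omega> place by (auto simp: regular_differentials_def N_def)
qed

lemma differentials_over_subset:
  assumes "subring S K"
  shows "differentials_over K k S \<subseteq> carrier \<Omega>"
proof -
  interpret module "K\<lparr>carrier := S\<rparr>" \<Omega>
    by (rule module_over_subring) fact
  show ?thesis
    unfolding differentials_over_def
    using subringE(1)[OF assms] differential_mem by (intro span_is_subset2) auto
qed

lemma regular_differentials_eq:
  assumes der: "\<And>\<delta>. \<delta> \<in> derivations K k \<Longrightarrow>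
    \<exists>t. \<forall>u\<in>carrier K. \<psi> (\<delta> u) = t * deriv_fract (\<psi> u)"
  shows "regular_differentials K k = {\<zero>\<^bsub>\<Omega>\<^esub>}"
proof (intro equalityI subsetI)
  fix \<omega> assume \<omega>: "\<omega> \<in> regular_differentials K k"
  hence carrier: "\<omega> \<in> derivations K k \<rightarrow>\<^sub>E carrier K"
    using differentials_over_subset[OF carrier_is_subring] carrier_\<Omega>
    by (auto simp: regular_differentials_def)
  have "\<omega> \<delta> = \<zero>" if \<delta>: "\<delta> \<in> derivations K k" for \<delta>
  proof -
    obtain t where t: "\<And>u. u \<in> carrier K \<Longrightarrow> \<psi> (\<delta> u) = t * deriv_fract (\<psi> u)"
      using der[OF \<delta>] by blast
    have finite_places: "\<exists>g\<in>local_ring_at c. \<psi> (\<omega> \<delta>) = t * g" for c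
    proof -
      interpret W: rational_place "local_ring_at c"
        by (rule rational_place_local_ring_at)
      show ?thesis
        by (rule regular_differential_pullback[OF W.rational_place_axioms W.zero_mem W.add_mem
              W.mult_mem deriv_fract_local_ring_at \<omega> \<delta> t])
    qed
    have "\<exists>g\<in>vanishing_at_infinity 2. \<psi> (\<omega> \<delta>) = t * g"
      by (rule regular_differential_pullback[OF rational_place_vanishing_at_infinity
            zero_mem_vanishing_at_infinity add_mem_vanishing_at_infinity
            mult_mem_vanishing_at_infinity[of _ 0 _ 2, unfolded add_0]
            deriv_fract_vanishing_at_infinity \<omega> \<delta> t])
    then obtain g where g: "g \<in> vanishing_at_infinity 2" "\<psi> (\<omega> \<delta>) = t * g"
      by blast
    have "\<psi> (\<omega> \<delta>) = 0"
    proof (cases "t = 0")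
      case False
      \<comment> \<open>Every place yields its own coefficient; dividing by t shows that they all
        agree.\<close>
      have "g \<in> local_ring_at c" for c
        using finite_places[of c] g False by auto
      hence "g = 0"
        using g(1) by (intro eq_0_if_no_poles)
      thus ?thesis
        using g by simp
    qed (use g in simp)
    thus "\<omega> \<delta> = \<zero>"
      using hom_eq_0_iff carrier \<delta> by auto
  qed
  hence "\<omega> = restrict (\<lambda>\<delta>. \<zero>) (derivations K k)"
    using carrier by (intro extensionalityI[of _ "derivations K k"]) (auto simp: PiE_def)
  thus "\<omega> \<in> {\<zero>\<^bsub>\<Omega>\<^esub>}"
    by (simp add: func_space_def)
next
  fix \<omega> assume "\<omega> \<in> {\<zero>\<^bsub>\<Omega>\<^esub>}"
  thus "\<omega> \<in> regular_differentials K k"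
    using zero_mem_differentials_over carrier_is_subring
    by (auto simp: regular_differentials_def places_def)
qed

lemma function_field_genus_eq_0:
  assumes "\<And>\<delta>. \<delta> \<in> derivations K k \<Longrightarrow>
    \<exists>t. \<forall>u\<in>carrier K. \<psi> (\<delta> u) = t * deriv_fract (\<psi> u)"
  shows "function_field_genus K k = 0"
proof -
  let ?k = "K\<lparr>carrier := k\<rparr>" and ?\<Omega> = "\<Omega>\<lparr>carrier := {\<zero>\<^bsub>\<Omega>\<^esub>}\<rparr>"
  interpret M: module ?k \<Omega>
    using subfield_k by (intro module_over_subring) (rule subfieldE)
  have "LinearCombinations.submodule ?k {\<zero>\<^bsub>\<Omega>\<^esub>} \<Omega>"
    by unfold_locales auto
  hence "module ?k ?\<Omega>"
    by (rule M.submodule_is_module)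
  moreover have "field ?k"
    using subfield_iff(2)[OF subfield_k] .
  ultimately interpret V: vectorspace ?k ?\<Omega>
    by (simp add: vectorspace_def)
  \<comment> \<open>The empty generating set also gives finite dimension; otherwise the genus would
    be \<infinity> by definition.\<close>
  have "V.gen_set {}"
    by (auto simp: V.span_def V.lincomb_def)
  hence "V.fin_dim" "V.dim = 0"
    using V.gen_ge_dim[of "{}"] by (auto simp: V.fin_dim_def)
  moreover have "regular_differentials K k = {\<zero>\<^bsub>\<Omega>\<^esub>}"
    by (rule regular_differentials_eq) (rule assms)
  ultimately show ?thesis
    by (simp add: function_field_genus_def Let_def zero_enat_def)
qed

end

section \<open>Derivations of the function field\<close>

context rational_embedding
begin

text \<open>Subtracting from \<open>\<delta>\<close> the multiple of d/d\<lambda> with the same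
  value at \<open>a\<close> leaves a derivation that kills the constants and \<open>a\<close>.
  Differentiating f(a, b) = 0 shows that it kills \<open>b\<close>, and hence every quotient of
  polynomials in \<open>a\<close> and \<open>b\<close>.\<close>

lemma derivation_eq_multiple:
  assumes gen: "\<psi> ` carrier K = {eval2 p a b / eval2 q a b | p q. eval2 q a b \<noteq> 0}"
    and f: "eval2 f a b = 0" "eval2 (pderiv f) a b \<noteq> 0"
    and a: "\<psi> x = a"
    and \<delta>: "\<delta> \<in> derivations K k"
  shows "\<exists>t. \<forall>u\<in>carrier K. \<psi> (\<delta> u) = t * deriv_fract (\<psi> u)"
proof -
  define M where "M = \<psi> ` carrier K"
  define t where "t = \<psi> (\<delta> x) / deriv_fract a"
  \<comment> \<open>The use of \<open>inv_into\<close> makes \<open>E\<close> meaningful on the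
    image \<open>M\<close> only.\<close>
  define E where "E m = \<psi> (\<delta> (inv_into (carrier K) \<psi> m)) - t * deriv_fract m" for m
  have closed: "\<delta> u \<in> carrier K" if "u \<in> carrier K" for u
    using \<delta> that by (auto simp: derivations_def)
  have E_\<psi>: "E (\<psi> u) = \<psi> (\<delta> u) - t * deriv_fract (\<psi> u)" if "u \<in> carrier K" for u
    using that inj by (simp add: E_def)
  have M_add: "m + n \<in> M" and E_add: "E (m + n) = E m + E n"
    and M_mult: "m * n \<in> M" and E_mult: "E (m * n) = E m * n + m * E n"
    if mn: "m \<in> M" "n \<in> M" for m n
  proof -
    obtain u v where uv: "u \<in> carrier K" "v \<in> carrier K" "m = \<psi> u" "n = \<psi> v"
      using mn by (auto simp: M_def)
    have add: "m + n = \<psi> (u \<oplus> v)" and mult: "m * n = \<psi> (u \<otimes> v)"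
      using uv by (simp_all add: hom_add hom_mult)
    show "m + n \<in> M" "m * n \<in> M"
      using uv unfolding add mult M_def by auto
    have "\<delta> (u \<oplus> v) = \<delta> u \<oplus> \<delta> v" "\<delta> (u \<otimes> v) = (\<delta> u \<otimes> v) \<oplus> (u \<otimes> \<delta> v)"
      using \<delta> uv by (auto simp: derivations_def)
    moreover have "E (\<psi> (u \<oplus> v)) = \<psi> (\<delta> (u \<oplus> v)) - t * deriv_fract (\<psi> (u \<oplus> v))"
      "E (\<psi> (u \<otimes> v)) = \<psi> (\<delta> (u \<otimes> v)) - t * deriv_fract (\<psi> (u \<otimes> v))"
      using uv by (intro E_\<psi>; simp)+
    ultimately show "E (m + n) = E m + E n" "E (m * n) = E m * n + m * E n"
      using uv(1,2) closed unfolding uv(3,4)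
      by (simp_all add: E_\<psi> hom_add hom_mult deriv_fract_add deriv_fract_mult algebra_simps)
  qed
  have M_const: "const_fract c \<in> M" and E_const: "E (const_fract c) = 0" for c
  proof -
    obtain u where u: "u \<in> k" "\<psi> u = const_fract c"
      using image_k by (metis rangeI imageE)
    moreover have "\<delta> u = \<zero>"
      using \<delta> u by (auto simp: derivations_def)
    moreover have "u \<in> carrier K"
      using u k_subset by auto
    ultimately show "const_fract c \<in> M" "E (const_fract c) = 0"
      using E_\<psi>[of u] unfolding M_def by (auto simp: hom_zero intro: rev_image_eqI)
  qed
  have M_0: "0 \<in> M" and E_0: "E 0 = 0"
    using M_const[of 0] E_const[of 0] by simp_all
  have M_a: "a \<in> M" and E_a: "E a = 0"
    using x E_\<psi>[of x] a by (auto simp: M_def t_def)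
  note poly_rule = derivation_poly[of M E, OF M_0 M_add M_mult E_add E_mult]
  have eval1: "eval1 c a \<in> M \<and> E (eval1 c a) = 0" for c
    unfolding eval1_def using poly_rule[of "map_poly const_fract c" a] M_a E_a
    by (simp add: coeff_map_poly M_const E_const)
  have "b = eval2 [:0, 1:] a b / eval2 1 a b" "eval2 1 a b \<noteq> 0"
    by simp_all
  hence "b \<in> M"
    unfolding M_def gen by blast
  hence eval2: "eval2 g a b \<in> M \<and> E (eval2 g a b) = eval2 (pderiv g) a b * E b" for g
    unfolding eval2_def eval1.map_poly_pderiv
    using poly_rule[of "map_poly (\<lambda>c. eval1 c a) g" b]
    by (simp add: coeff_map_poly eval1)
  \<comment> \<open>Applying \<open>E\<close> to f(a, b) = 0 leaves the partial derivative of f in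
    y, which is nonzero at (a, b), times \<open>E b\<close>.\<close>
  have E_b: "E b = 0"
    using eval2[of f] f E_0 by simp
  have "E m = 0" if mem: "m \<in> M" for m
  proof -
    obtain p q where m: "m = eval2 p a b / eval2 q a b" and q: "eval2 q a b \<noteq> 0"
      using mem unfolding M_def gen by blast
    have "E (m * eval2 q a b) = E m * eval2 q a b"
      using E_mult[OF mem, of "eval2 q a b"] eval2[of q] E_b by simp
    moreover have "m * eval2 q a b = eval2 p a b"
      using q by (simp add: m)
    ultimately show ?thesis
      using eval2[of p] E_b q by simp
  qed
  thus ?thesis
    using E_\<psi> by (intro exI[of _ t]) (auto simp: M_def)
qed

end

subsection \<open>Rational curves have genus zero\<close>

text \<open>The description is meaningful for fractions that admit a denominator not vanishing at
  (a, b); these will form the local ring of the curve.\<close>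

definition eval_fract ::
    "'k::field poly fract \<Rightarrow> 'k poly fract \<Rightarrow> 'k poly poly fract \<Rightarrow> 'k poly fract" where
  "eval_fract a b r = (THE t. \<exists>p q. r = Fract p q \<and> eval2 q a b \<noteq> 0 \<and>
     t = eval2 p a b / eval2 q a b)"

lemma eval_fract_Fract:
  assumes "eval2 q a b \<noteq> 0"
  shows "eval_fract a b (Fract p q) = eval2 p a b / eval2 q a b"
  unfolding eval_fract_def
proof (rule the_equality)
  fix t assume "\<exists>p' q'. Fract p q = Fract p' q' \<and> eval2 q' a b \<noteq> 0 \<and>
     t = eval2 p' a b / eval2 q' a b"
  then obtain p' q' where *: "Fract p q = Fract p' q'" "eval2 q' a b \<noteq> 0"
    "t = eval2 p' a b / eval2 q' a b"
    by blast
  have "q \<noteq> 0" "q' \<noteq> 0"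
    using assms * by auto
  hence "p * q' = p' * q"
    using * by (simp add: eq_fract)
  hence "eval2 p a b * eval2 q' a b = eval2 p' a b * eval2 q a b"
    by (metis eval2.hom_mult)
  thus "t = eval2 p a b / eval2 q a b"
    using *(2) assms unfolding *(3) by (simp add: frac_eq_eq)
qed (use assms in blast)

text \<open>Exactly the multiples of \<open>f\<close> vanish at (a, b), so evaluation is defined on
  the local ring and its kernel is the maximal ideal. The function field, being the residue field,
  therefore embeds into \<complex>(\<lambda>).\<close>

theorem plane_curve_genus_eq_0:
  assumes f: "irreducible f" "degree f > 0" "eval2 f a b = 0" and a: "deriv_fract a \<noteq> 0"
  shows "plane_curve_genus f = 0"
proof -
  let ?R = "curve_local_ring f" and ?I = "curve_ideal f" and ?K = "curve_function_field f"
  let ?T = "ring_of_type_algebra :: complex poly poly fract ring"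
  let ?S = "ring_of_type_algebra :: complex poly fract ring"
  let ?h = "eval_fract a b"
  have dvd_iff: "f dvd g \<longleftrightarrow> eval2 g a b = 0" for g
    using irreducible_dvd_of_eval2_eq_0[OF f a] f(3) by (auto simp: eval2.hom_mult)
  have nz: "q \<noteq> 0" if "eval2 q a b \<noteq> 0" for q
    using that by auto
  have carrier_R: "carrier ?R = {Fract p q | p q. eval2 q a b \<noteq> 0}"
    by (simp add: curve_local_ring_def dvd_iff)
  have ops_R: "u \<oplus>\<^bsub>?R\<^esub> v = u + v" "u \<otimes>\<^bsub>?R\<^esub> v = u * v" "\<one>\<^bsub>?R\<^esub> = 1" "\<zero>\<^bsub>?R\<^esub> = 0" for u v
    by (simp_all add: curve_local_ring_def ring_of_type_algebra_def)
  have ops_S: "u \<oplus>\<^bsub>?S\<^esub> v = u + v" "u \<otimes>\<^bsub>?S\<^esub> v = u * v" "\<one>\<^bsub>?S\<^esub> = 1" "\<zero>\<^bsub>?S\<^esub> = 0"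
    "carrier ?S = UNIV" for u v
    by (simp_all add: ring_of_type_algebra_def)

  interpret T: cring ?T ..
  interpret S: field ?S ..
  have carrier_T: "carrier ?T = UNIV"
    by (simp add: ring_of_type_algebra_def)
  have "subring (carrier ?R) ?T"
  proof (rule T.subringI)
    show "\<one>\<^bsub>?T\<^esub> \<in> carrier ?R"
    proof -
      have "Fract 1 1 \<in> carrier ?R"
        unfolding carrier_R by (intro CollectI exI[of _ 1] conjI refl) simp
      thus ?thesis
        by (simp add: ring_of_type_algebra_def flip: One_fract_def)
    qed
    fix u assume "u \<in> carrier ?R"
    then obtain p q where u: "u = Fract p q" "eval2 q a b \<noteq> 0"
      by (auto simp: carrier_R)
    have "\<ominus>\<^bsub>?T\<^esub> u = - u"
      by (rule T.minus_equality) (simp_all add: ring_of_type_algebra_def)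
    thus "\<ominus>\<^bsub>?T\<^esub> u \<in> carrier ?R"
      using u by (auto simp: carrier_R)
    fix v assume "v \<in> carrier ?R"
    then obtain p' q' where v: "v = Fract p' q'" "eval2 q' a b \<noteq> 0"
      by (auto simp: carrier_R)
    have "eval2 (q * q') a b \<noteq> 0"
      using u v by (simp add: eval2.hom_mult)
    thus "u \<otimes>\<^bsub>?T\<^esub> v \<in> carrier ?R" "u \<oplus>\<^bsub>?T\<^esub> v \<in> carrier ?R"
      using u v nz by (auto simp: carrier_R ring_of_type_algebra_def)
  qed (simp add: carrier_T)
  hence "cring (?T\<lparr>carrier := carrier ?R\<rparr>)"
    using T.subcringI' T.subcring_iff carrier_T by blast
  moreover have "?T\<lparr>carrier := carrier ?R\<rparr> = ?R"
    by (simp add: curve_local_ring_def)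
  ultimately interpret R: cring ?R
    by simp

  have h_Fract: "?h (Fract p q) = eval2 p a b / eval2 q a b" if "eval2 q a b \<noteq> 0" for p q
    using that by (rule eval_fract_Fract)
  interpret h: ring_hom_ring ?R ?S ?h
  proof (rule ring_hom_ringI)
    fix u v assume "u \<in> carrier ?R" "v \<in> carrier ?R"
    then obtain p q p' q' where *: "u = Fract p q" "eval2 q a b \<noteq> 0" "v = Fract p' q'" "eval2 q' a b \<noteq> 0"
      by (auto simp: carrier_R)
    have qq': "eval2 (q * q') a b \<noteq> 0"
      using * by (simp add: eval2.hom_mult)
    have "u * v = Fract (p * p') (q * q')" "u + v = Fract (p * q' + p' * q) (q * q')"
      using * nz by simp_all
    thus "?h (u \<otimes>\<^bsub>?R\<^esub> v) = ?h u \<otimes>\<^bsub>?S\<^esub> ?h v" "?h (u \<oplus>\<^bsub>?R\<^esub> v) = ?h u \<oplus>\<^bsub>?S\<^esub> ?h v"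
      using *(2,4) unfolding ops_R ops_S *(1,3)
      by (simp_all add: h_Fract[OF qq'] h_Fract[OF *(2)] h_Fract[OF *(4)] eval2.hom_mult
          eval2.hom_add add_frac_eq)
  next
    show "?h \<one>\<^bsub>?R\<^esub> = \<one>\<^bsub>?S\<^esub>"
      using h_Fract[of 1 1] by (simp add: ops_R ops_S flip: One_fract_def)
  qed (simp_all add: ops_S R.ring_axioms S.ring_axioms)

  have I: "?I = a_kernel ?R ?S ?h"
  proof -
    have "?I = {u \<in> carrier ?R. ?h u = 0}"
    proof (intro equalityI subsetI)
      fix u assume "u \<in> ?I"
      then obtain p q where *: "u = Fract p q" "eval2 p a b = 0" "eval2 q a b \<noteq> 0"
        unfolding curve_ideal_def dvd_iff by blast
      hence "?h u = 0"
        by (simp add: h_Fract)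
      thus "u \<in> {u \<in> carrier ?R. ?h u = 0}"
        using * unfolding carrier_R by blast
    next
      fix u assume u: "u \<in> {u \<in> carrier ?R. ?h u = 0}"
      then obtain p q where *: "u = Fract p q" "eval2 q a b \<noteq> 0"
        unfolding carrier_R by blast
      hence "eval2 p a b = 0"
        using u by (simp add: h_Fract)
      thus "u \<in> ?I"
        using * unfolding curve_ideal_def dvd_iff by blast
    qed
    thus ?thesis
      unfolding a_kernel_def' ops_S .
  qed
  \<comment> \<open>Evaluation is constant on each coset of its kernel, so the image of a coset is a
    singleton.\<close>
  define \<psi> where "\<psi> A = the_elem (?h ` A)" for A
  have K: "?K = ?R Quot a_kernel ?R ?S ?h"
    by (simp add: curve_function_field_def I)
  have \<psi>_coset: "\<psi> (?I +>\<^bsub>?R\<^esub> u) = ?h u" if "u \<in> carrier ?R" for u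
    using that by (simp add: \<psi>_def I)
  have \<psi>_hom: "\<psi> \<in> Ring.ring_hom ?K ?S"
    unfolding \<psi>_def[abs_def] K by (rule h.the_elem_hom)
  have \<psi>_inj: "inj_on \<psi> (carrier ?K)"
    unfolding \<psi>_def[abs_def] K by (rule inj_onI) (rule h.the_elem_inj)
  have carrier_K: "carrier ?K = (\<lambda>u. ?I +>\<^bsub>?R\<^esub> u) ` carrier ?R"
    unfolding curve_function_field_def FactRing_def A_RCOSETS_def' by auto
  have image_K: "\<psi> ` carrier ?K = {eval2 p a b / eval2 q a b | p q. eval2 q a b \<noteq> 0}"
  proof -
    have "\<psi> ` carrier ?K = ?h ` carrier ?R"
      unfolding carrier_K image_image by (intro image_cong) (simp_all add: \<psi>_coset)
    also have "\<dots> = {eval2 p a b / eval2 q a b | p q. eval2 q a b \<noteq> 0}"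
      by (force simp: carrier_R h_Fract)
    finally show ?thesis .
  qed

  interpret I: ideal ?I ?R
    unfolding I by (rule h.kernel_is_ideal)
  interpret K: cring ?K
    unfolding curve_function_field_def by (rule I.quotient_is_cring) (rule R.cring_axioms)
  have \<psi>_add: "\<psi> (A \<oplus>\<^bsub>?K\<^esub> B) = \<psi> A + \<psi> B" and \<psi>_mult: "\<psi> (A \<otimes>\<^bsub>?K\<^esub> B) = \<psi> A * \<psi> B"
    if "A \<in> carrier ?K" "B \<in> carrier ?K" for A B
    using Ring.ring_hom_add[OF \<psi>_hom that] Ring.ring_hom_mult[OF \<psi>_hom that] by (simp_all add: ops_S)
  have \<psi>_one: "\<psi> \<one>\<^bsub>?K\<^esub> = 1"
    using Ring.ring_hom_one[OF \<psi>_hom] by (simp add: ops_S)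
  have \<psi>_zero: "\<psi> \<zero>\<^bsub>?K\<^esub> = 0"
    using \<psi>_add[of "\<zero>\<^bsub>?K\<^esub>" "\<zero>\<^bsub>?K\<^esub>"] by (metis K.l_zero K.zero_closed add_cancel_right_right)
  \<comment> \<open>Inverses are found in the image of \<open>\<psi>\<close>, where a nonzero
    fraction can be turned upside down.\<close>
  interpret K: field ?K
  proof (rule K.cring_fieldI2)
    show "\<zero>\<^bsub>?K\<^esub> \<noteq> \<one>\<^bsub>?K\<^esub>"
      using \<psi>_one \<psi>_zero by force
    fix A assume A: "A \<in> carrier ?K" "A \<noteq> \<zero>\<^bsub>?K\<^esub>"
    have "\<psi> A \<noteq> 0"
      using \<psi>_inj A \<psi>_zero by (metis K.zero_closed inj_on_eq_iff)
    moreover obtain p q where pq: "\<psi> A = eval2 p a b / eval2 q a b" "eval2 q a b \<noteq> 0"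
      using A(1) image_K by blast
    ultimately have "inverse (\<psi> A) = eval2 q a b / eval2 p a b" "eval2 p a b \<noteq> 0"
      by auto
    hence "inverse (\<psi> A) \<in> \<psi> ` carrier ?K"
      unfolding image_K by blast
    then obtain B where B: "B \<in> carrier ?K" "\<psi> B = inverse (\<psi> A)"
      by auto
    hence "\<psi> (A \<otimes>\<^bsub>?K\<^esub> B) = \<psi> \<one>\<^bsub>?K\<^esub>"
      using A \<open>\<psi> A \<noteq> 0\<close> by (simp add: \<psi>_mult \<psi>_one)
    hence "A \<otimes>\<^bsub>?K\<^esub> B = \<one>\<^bsub>?K\<^esub>"
      using \<psi>_inj A B by (metis K.m_closed K.one_closed inj_on_eq_iff)
    thus "\<exists>B\<in>carrier ?K. A \<otimes>\<^bsub>?K\<^esub> B = \<one>\<^bsub>?K\<^esub>"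
      using B by blast
  qed

  have poly_mem: "to_fract p \<in> carrier ?R" and h_poly: "?h (to_fract p) = eval2 p a b" for p
  proof -
    have "eval2 1 a b \<noteq> 0"
      by simp
    thus "to_fract p \<in> carrier ?R"
      unfolding carrier_R to_fract_def by blast
    show "?h (to_fract p) = eval2 p a b"
      using h_Fract[of 1 p] by (simp add: to_fract_def)
  qed
  define x where "x = ?I +>\<^bsub>?R\<^esub> to_fract [:[:0, 1:]:]"
  have \<psi>_x: "\<psi> x = a"
    unfolding x_def by (simp add: \<psi>_coset poly_mem h_poly)
  interpret rational_embedding ?K "curve_constants f" \<psi> x
  proof
    show "curve_constants f \<subseteq> carrier ?K"
      using poly_mem by (auto simp: curve_constants_def carrier_K)
    show "\<psi> ` curve_constants f = range const_fract"
    proof -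
      have "curve_constants f = (\<lambda>c. ?I +>\<^bsub>?R\<^esub> to_fract [:[:c:]:]) ` UNIV"
        by (auto simp: curve_constants_def)
      thus ?thesis
        by (simp add: image_image \<psi>_coset poly_mem h_poly)
    qed
    show "x \<in> carrier ?K"
      using poly_mem by (simp add: x_def carrier_K)
  qed (simp_all add: \<psi>_add \<psi>_mult \<psi>_one \<psi>_inj \<psi>_x a)
  \<comment> \<open>In characteristic 0 the derivative is nonzero and of smaller degree. Hence
    \<open>b\<close> is a simple root of f(a, y).\<close>
  have "\<not> f dvd pderiv f"
    using f(2) by simp
  hence "eval2 (pderiv f) a b \<noteq> 0"
    unfolding dvd_iff .
  thus ?thesis
    unfolding plane_curve_genus_def
    by (intro function_field_genus_eq_0 derivation_eq_multiple[OF image_K f(3) _ \<psi>_x])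
qed

theorem theorem2p4:
  fixes F :: "complex poly fract poly poly"
  assumes "Factorial_Ring.irreducible F"
    and "Polynomial.degree F > 0"
    and "\<exists>r. rational_general_solution F r \<and> \<not> constant_in_z r"
  shows "finite {z\<^sub>0. \<not> (Factorial_Ring.irreducible (specialize z\<^sub>0 F) \<and>
                         plane_curve_genus (specialize z\<^sub>0 F) = 0)}"
proof -
  obtain r where "deriv_lam r \<noteq> 0" "subst_diff_poly F r (deriv_z r) = 0"
    using assms(3) by (auto simp: rational_general_solution_def)
  \<comment> \<open>The operations on \<complex>(z,\<lambda>) are the generic ones over the base
    field \<complex>(z); the point on the generic curve is (r, \<partial>r/\<partial>z).\<close>
  hence "deriv_fract r \<noteq> 0" "eval2 F r (deriv_z r) = 0"
    by (simp_all add: deriv_lam_def deriv_fract_def eval2_eq_subst_diff_poly)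
  with assms(1,2) have "\<forall>\<^sub>\<infinity>z. irreducible (specialize z F) \<and> degree (specialize z F) > 0 \<and>
    (\<exists>a b. eval2 (specialize z F) a b = 0 \<and> deriv_fract a \<noteq> 0)"
    by (intro eventually_irreducible_specialize)
  hence "\<forall>\<^sub>\<infinity>z. irreducible (specialize z F) \<and> plane_curve_genus (specialize z F) = 0"
    by eventually_elim (use plane_curve_genus_eq_0 in blast)
  thus ?thesis
    by (simp add: eventually_cofinite)
qed

end
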